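(* For each $n\ge 0$ and $k=0,\ldots,p-1$, the function $\psi_{n,k}$ has exactly $Z(n,k)$ zeros in $\mathbb{C}\setminus([a_{k-1},b_{k-1}]\cup\{0\})$ (where $[a_{-1},b_{-1}]:=\emptyset$); they are all simple and lie in the open interval $(a_k,b_k)$. The function $\psi_{n,p}$ has no zeros in $\mathbb{C}\setminus([a_{p-1},b_{p-1}]\cup\{0\})$.
   Context: Setting. Fix an integer $p\ge 1$. For $0\le j\le p-1$ let $a_j<b_j$ be real numbers with $0\le a_j<b_j$ if $j$ is even and $a_j<b_j\le 0$ if $j$ is odd, and let $\Gamma_j=\{z\in\mathbb{C}: z^{p+1}\in[a_j,b_j]\}$. Assume $\Gamma_j\cap\Gamma_{j+1}=\emptyset$ for $0\le j\le p-2$. For each $j$ let $\sigma_j$ be a positive finite Borel measure on $\Gamma_j$, invariant under rotation by the angle $2\pi/(p+1)$, with infinitely many points in its support. Nikishin system. Set $s_{k,k}=\sigma_k$ and, for $0\le k<j\le p-1$, $ds_{k,j}(z)=\Big(\int_{\Gamma_{k+1}}\frac{ds_{k+1,j}(t)}{z-t}\Big)d\sigma_k(z)$ on $\Gamma_k$; put $s_j=s_{0,j}$. Multi-orthogonal polynomials. $Q_n$ ($n\ge0$) is the monic polynomial of lowest degree satisfying $\int_{\Gamma_0}Q_n(z)z^l\,ds_j(z)=0$ for $l=0,\ldots,\lfloor\frac{n-j-1}{p}\rfloor$, $0\le j\le p-1$. The Nikishin system is normal: $\deg Q_n=n$. Let $\ell\in\{0,\ldots,p\}$ be the residue of $n$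 mod $p+1$, and $d=\lfloor n/(p+1)\rfloor$. By symmetry, $Q_n(t)=t^\ell\mathcal{Q}_d(t^{p+1})$ for a polynomial $\mathcal{Q}_d$ of degree $d$. Functions of the second kind. $\Psi_{n,0}=Q_n$ and $\Psi_{n,k}(z)=\int_{\Gamma_{k-1}}\frac{\Psi_{n,k-1}(t)}{z-t}d\sigma_{k-1}(t)$ for $1\le k\le p$. Set $\psi_{n,0}=\mathcal{Q}_d$ and, for $1\le k\le p$, $z\in\mathbb{C}\setminus[a_{k-1},b_{k-1}]$, $\psi_{n,k}(z)=z\int_{\Gamma_{k-1}}\frac{\Psi_{n,k-1}(t)t^{k-1-\ell}}{z-t^{p+1}}d\sigma_{k-1}(t)$ if $\ell<k$, and $\psi_{n,k}(z)=\int_{\Gamma_{k-1}}\frac{\Psi_{n,k-1}(t)t^{p+k-\ell}}{z-t^{p+1}}d\sigma_{k-1}(t)$ if $k\le\ell$. Counting numbers. For $0\le j\le p-1$ let $M_j$ be the number of integers $s$ with $\lceil\frac{\ell-j}{p+1}\rceil\le s\le\lfloor\frac{n+p\ell-1-j(p+1)}{p(p+1)}\rfloor$, and $Z(n,k)=\sum_{j=k}^{p-1}M_j$ for $0\le k\le p-1$, $Z(n,p)=0$. *)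

theory Defs
  imports "HOL-Complex_Analysis.Complex_Analysis"
begin

definition star_set :: "nat \<Rightarrow> (nat \<Rightarrow> real) \<Rightarrow> (nat \<Rightarrow> real) \<Rightarrow> nat \<Rightarrow> complex set" where
  "star_set p a b j = {z. z ^ (p + 1) \<in> complex_of_real ` {a j..b j}}"

definition measure_support :: "'a::topological_space measure \<Rightarrow> 'a set" where
  "measure_support M = {x. \<forall>U. open U \<longrightarrow> x \<in> U \<longrightarrow> emeasure M U > 0}"

(* The measures sigma_j are modelled as Borel measures on the whole complex plane for which the
   complement of Gamma_j is a null set; an integral over Gamma_j is therefore the integral
   with respect to sigma_j. *)
definition star_measure ::
  "nat \<Rightarrow> (nat \<Rightarrow> real) \<Rightarrow> (nat \<Rightarrow> real) \<Rightarrow> nat \<Rightarrow> complex measure \<Rightarrow> bool" where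
  "star_measure p a b j M \<longleftrightarrow>
     sets M = sets borel \<and> finite_measure M \<and>
     emeasure M (- star_set p a b j) = 0 \<and>
     distr M borel (\<lambda>z. cis (2 * pi / real (p + 1)) * z) = M \<and>
     infinite (measure_support M)"

(* The complex measure s_{k,j} is absolutely continuous with respect to sigma_k by definition.
   nikishin_density sigma k m is the density of s_{k,k+m} with respect to sigma_k, so that
   integrating f against s_{k,j} means integrating f * nikishin_density sigma k (j - k)
   against sigma_k. *)
primrec nikishin_density ::
  "(nat \<Rightarrow> complex measure) \<Rightarrow> nat \<Rightarrow> nat \<Rightarrow> complex \<Rightarrow> complex" where
  "nikishin_density \<sigma> k 0 = (\<lambda>z. 1)"
| "nikishin_density \<sigma> k (Suc m) =
     (\<lambda>z. LINT t|\<sigma> (Suc k). nikishin_density \<sigma> (Suc k) m t / (z - t))"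

(* For n <= j the floor below is -1 and the condition on l is void. *)
definition multi_orthogonal ::
  "nat \<Rightarrow> (nat \<Rightarrow> complex measure) \<Rightarrow> nat \<Rightarrow> complex poly \<Rightarrow> bool" where
  "multi_orthogonal p \<sigma> n q \<longleftrightarrow>
     (\<forall>j<p. \<forall>l::nat. int l \<le> \<lfloor>(real n - real j - 1) / real p\<rfloor> \<longrightarrow>
        (LINT z|\<sigma> 0. poly q z * z ^ l * nikishin_density \<sigma> 0 j z) = 0)"

definition Qpoly :: "nat \<Rightarrow> (nat \<Rightarrow> complex measure) \<Rightarrow> nat \<Rightarrow> complex poly" where
  "Qpoly p \<sigma> n = (THE q. lead_coeff q = 1 \<and> multi_orthogonal p \<sigma> n q \<and>
     (\<forall>r. lead_coeff r = 1 \<and> multi_orthogonal p \<sigma> n r \<longrightarrow> degree q \<le> degree r))"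

definition reduced_Qpoly :: "nat \<Rightarrow> (nat \<Rightarrow> complex measure) \<Rightarrow> nat \<Rightarrow> complex poly" where
  "reduced_Qpoly p \<sigma> n =
     (THE q. \<forall>t. poly (Qpoly p \<sigma> n) t = t ^ (n mod (p + 1)) * poly q (t ^ (p + 1)))"

primrec Psi ::
  "nat \<Rightarrow> (nat \<Rightarrow> complex measure) \<Rightarrow> nat \<Rightarrow> nat \<Rightarrow> complex \<Rightarrow> complex" where
  "Psi p \<sigma> n 0 = poly (Qpoly p \<sigma> n)"
| "Psi p \<sigma> n (Suc k) = (\<lambda>z. LINT t|\<sigma> k. Psi p \<sigma> n k t / (z - t))"

(* All natural-number subtractions in the exponents are exact, because n mod (p + 1) <= p. *)
definition psi ::
  "nat \<Rightarrow> (nat \<Rightarrow> complex measure) \<Rightarrow> nat \<Rightarrow> nat \<Rightarrow> complex \<Rightarrow> complex" where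
  "psi p \<sigma> n k z =
     (let r = n mod (p + 1) in
      if k = 0 then poly (reduced_Qpoly p \<sigma> n) z
      else if r < k then
        z * (LINT t|\<sigma> (k - 1). Psi p \<sigma> n (k - 1) t * t ^ (k - 1 - r) / (z - t ^ (p + 1)))
      else
        (LINT t|\<sigma> (k - 1). Psi p \<sigma> n (k - 1) t * t ^ (p + k - r) / (z - t ^ (p + 1))))"

(* cut a b k is the interval [a_{k-1}, b_{k-1}], empty for k = 0. *)
definition cut :: "(nat \<Rightarrow> real) \<Rightarrow> (nat \<Rightarrow> real) \<Rightarrow> nat \<Rightarrow> complex set" where
  "cut a b k = (if k = 0 then {} else complex_of_real ` {a (k - 1)..b (k - 1)})"

definition psi_zeros ::
  "nat \<Rightarrow> (nat \<Rightarrow> real) \<Rightarrow> (nat \<Rightarrow> real) \<Rightarrow> (nat \<Rightarrow> complex measure) \<Rightarrow> nat \<Rightarrow> nat \<Rightarrow> complex set"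
  where
  "psi_zeros p a b \<sigma> n k = {z \<in> - (cut a b k \<union> {0}). psi p \<sigma> n k z = 0}"

definition Mcount :: "nat \<Rightarrow> nat \<Rightarrow> nat \<Rightarrow> nat" where
  "Mcount p n j =
     (let r = n mod (p + 1) in
      card {s::int. \<lceil>(real r - real j) / (real p + 1)\<rceil> \<le> s \<and>
        s \<le> \<lfloor>(real n + real p * real r - 1 - real j * (real p + 1)) / (real p * (real p + 1))\<rfloor>})"

definition Zcount :: "nat \<Rightarrow> nat \<Rightarrow> nat \<Rightarrow> nat" where
  "Zcount p n k = (\<Sum>j = k..<p. Mcount p n j)"

end

theory Submission
  imports Defs
begin

text \<open>
  The substitution x = t^(p + 1) pushes each sigma_k to a measure mu_k on [a_k, b_k] and turns the
  functions psi_{n,k} into iterated Cauchy transforms f_k of f_0 = Q_d. With l = n mod (p + 1) the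
  orthogonality conditions become a window of consecutive ones, namely f_0 is orthogonal to
  x^(u div p) times the reduced Nikishin density of index u mod p for all u with l <= u < l + d.
  Fubini hands the conditions with u mod p >= k over to f_k; those with u mod p = k say that
  f_k x^c dmu_k annihilates all polynomials of degree < M_k, where c is 0 or 1.

  If T is a real polynomial of degree N whose roots are zeros of f_{k+1} off [a_k, b_k], then
  partial fractions show that f_k x^c dmu_k / T annihilates all polynomials of degree < M_k + N,
  whence f_k has at least M_k + N zeros in (a_k, b_k). Climbing down from f_p gives at least Z(n,k)
  zeros of f_k there. Conversely a surplus (or multiple) zero of f_k, carried down to f_0, produces
  more than d zeros of the polynomial f_0. The same count for f_0 alone gives normality, applied to
  the components of a polynomial with respect to the residues of the exponents mod p + 1.
\<close>

section \<open>Zeros of functions orthogonal to polynomials\<close>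

text \<open>Write r = n mod (p + 1). A condition with exponent l and index j survives the rotation
  only if r + l = s (p + 1) + j for some s. With u = s p + j this reads l = u + s - r; then p l + j
  < n becomes u < r + d, and l \<ge> 0 becomes u \<ge> r. So there are exactly d conditions for a
  polynomial of degree d, and the bounds from below and from above meet with nothing to spare.

  The exponent c has a similar origin: passing from powers of t to powers of x leaves one factor x
  at each level, and whether it stands inside the Cauchy integral (c = 1) or in front of it depends
  on k < r. It creates no zeros in (a_k, b_k), because these intervals omit 0.

  The sign argument needs real functions, so the root set of T must be closed under conjugation,
  whereas \<open>Qpoly\<close> is a complex polynomial given by a definite description. Hence a real
  polynomial is constructed first, and normality is proved for arbitrary complex polynomials,
  without presupposing their symmetry, in order to identify the two.\<close>

lemma borel_measurable_poly [measurable]: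
  fixes P :: "'a::{real_normed_field, second_countable_topology} poly"
  shows "poly P \<in> borel_measurable borel"
  by (intro borel_measurable_continuous_onI continuous_intros)

lemma constant_sign_Ioo:
  fixes f :: "real \<Rightarrow> real"
  assumes "continuous_on {u<..<v} f" and "\<And>x. x \<in> {u<..<v} \<Longrightarrow> f x \<noteq> 0"
  obtains c :: real where "c \<noteq> 0" "\<And>x. x \<in> {u<..<v} \<Longrightarrow> c * f x > 0"
proof (cases "\<exists>x\<in>{u<..<v}. f x < 0")
  case False
  then show ?thesis using that[of 1] assms(2) by force
next
  case True
  have "connected (f ` {u<..<v})"
    by (rule connected_continuous_image[OF assms(1)]) simp
  then have "f x < 0" if "x \<in> {u<..<v}" for x
    using True that assms(2) connectedD_interval[of "f ` {u<..<v}"]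
    by (smt (verit, best) image_iff)
  then show ?thesis using that[of "-1"] by force
qed

text \<open>The linear factors of P sit at the zeros where f changes sign. The induction shrinks the
  interval from the right: left of the largest zero y there is one zero fewer.\<close>

lemma sign_polynomial:
  fixes f :: "real \<Rightarrow> real"
  assumes "continuous_on {\<alpha><..<\<beta>} f" and "finite {x\<in>{\<alpha><..<\<beta>}. f x = 0}"
  shows "\<exists>P. degree P \<le> card {x\<in>{\<alpha><..<\<beta>}. f x = 0} \<and>
    (\<forall>x. poly P x = 0 \<longrightarrow> x \<in> {\<alpha><..<\<beta>} \<and> f x = 0) \<and> (\<forall>x\<in>{\<alpha><..<\<beta>}. 0 \<le> poly P x * f x)"
  using assms
proof (induction "card {x\<in>{\<alpha><..<\<beta>}. f x = 0}" arbitrary: \<beta>)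
  case 0
  then have nz: "\<And>x. x \<in> {\<alpha><..<\<beta>} \<Longrightarrow> f x \<noteq> 0" by auto
  obtain c where c: "c \<noteq> 0" "\<And>x. x \<in> {\<alpha><..<\<beta>} \<Longrightarrow> c * f x > 0"
    using constant_sign_Ioo[OF 0(2) nz] by metis
  show ?case
    by (rule exI[of _ "[:c:]"]) (use c in \<open>auto intro: less_imp_le\<close>)
next
  case (Suc N)
  define Y where "Y = {x\<in>{\<alpha><..<\<beta>}. f x = 0}"
  have Y: "finite Y" "card Y = Suc N" using Suc by (simp_all add: Y_def)
  then have "Y \<noteq> {}" by force
  define y where "y = Max Y"
  have y: "y \<in> Y" "\<And>x. x \<in> Y \<Longrightarrow> x \<le> y" using Y \<open>Y \<noteq> {}\<close> by (auto simp: y_def)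
  have Y': "{x\<in>{\<alpha><..<y}. f x = 0} = Y - {y}"
    using y by (force simp: Y_def)
  have cY: "card (Y - {y}) = N" using Y y(1) by simp
  have "\<exists>P. degree P \<le> card {x\<in>{\<alpha><..<y}. f x = 0} \<and>
    (\<forall>x. poly P x = 0 \<longrightarrow> x \<in> {\<alpha><..<y} \<and> f x = 0) \<and> (\<forall>x\<in>{\<alpha><..<y}. 0 \<le> poly P x * f x)"
  proof (rule Suc(1))
    show "continuous_on {\<alpha><..<y} f"
      using y(1) by (intro continuous_on_subset[OF Suc(3)]) (auto simp: Y_def)
  qed (use y(1) Y in \<open>simp_all only: Y' card_Diff_singleton finite_Diff diff_Suc_1\<close>)
  then obtain P where P: "degree P \<le> N" "\<And>x. poly P x = 0 \<Longrightarrow> x \<in> {\<alpha><..<y} \<and> f x = 0"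
    "\<And>x. x\<in>{\<alpha><..<y} \<Longrightarrow> 0 \<le> poly P x * f x"
    unfolding Y' cY by blast
  have "y < \<beta>" "\<alpha> < y" "f y = 0" using y by (auto simp: Y_def)
  have nz: "poly P x * f x \<noteq> 0" if "x \<in> {y<..<\<beta>}" for x
    using P(2)[of x] y(2)[of x] that y(1) by (auto simp: Y_def)
  have cont: "continuous_on {y<..<\<beta>} (\<lambda>x. poly P x * f x)"
    using \<open>\<alpha> < y\<close> by (intro continuous_intros continuous_on_subset[OF Suc(3)]) auto
  \<comment> \<open>\<open>c\<close> records whether P f has the right sign beyond y. If not, the
    factor \<open>[:y, -1:]\<close>, positive left of y and negative right of it, repairs this at
    the cost of one degree, paid for by the zero y.\<close>
  obtain c where c: "c \<noteq> 0" "\<And>x. x \<in> {y<..<\<beta>} \<Longrightarrow> c * (poly P x * f x) > 0"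
    using constant_sign_Ioo[OF cont nz] by metis
  show ?case
  proof (cases "c > 0")
    case True
    have "0 \<le> poly P x * f x" if "x \<in> {\<alpha><..<\<beta>}" for x
      using P(3)[of x] c(2)[of x] that \<open>f y = 0\<close> True
      by (cases x y rule: linorder_cases) (auto simp: zero_less_mult_iff zero_le_mult_iff)
    then show ?thesis using P Y \<open>y < \<beta>\<close> by (fold Y_def, intro exI[of _ P]) force
  next
    case False
    have "0 \<le> poly (P * [:y, -1:]) x * f x" if x: "x \<in> {\<alpha><..<\<beta>}" for x
    proof (cases x y rule: linorder_cases)
      case less
      then have "0 \<le> (y - x) * (poly P x * f x)"
        using P(3)[of x] x mult_nonneg_nonneg[of "y - x" "poly P x * f x"] by simp
      then show ?thesis by (simp add: algebra_simps)
    next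
      case greater
      then have "poly P x * f x < 0"
        using c(2)[of x] x False c(1) by (auto simp: zero_less_mult_iff)
      then have "0 \<le> (y - x) * (poly P x * f x)"
        using greater by (intro mult_nonpos_nonpos) auto
      then show ?thesis by (simp add: algebra_simps)
    qed (use \<open>f y = 0\<close> in auto)
    moreover have "degree (P * [:y, -1:]) \<le> Suc N"
      using degree_mult_le[of P "[:y, -1:]"] P(1) by simp
    ultimately show ?thesis using P(2) Y \<open>y < \<beta>\<close> \<open>\<alpha> < y\<close> \<open>f y = 0\<close>
      by (fold Y_def, intro exI[of _ "P * [:y, -1:]"]) force
  qed
qed

text \<open>\<open>not_finite\<close> is the form in which the infinite support enters: a nonzero
  polynomial cannot vanish almost everywhere.\<close>

locale interval_measure = finite_measure \<mu> for \<mu> :: "real measure" +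
  fixes \<alpha> \<beta> :: real
  assumes sets_eq[measurable_cong, simp]: "sets \<mu> = sets borel"
    and less: "\<alpha> < \<beta>"
    and concentrated: "AE x in \<mu>. x \<in> {\<alpha>..\<beta>}"
    and not_finite: "finite F \<Longrightarrow> \<not> (AE x in \<mu>. x \<in> F)"
begin

lemma integrable_bounded:
  fixes f :: "real \<Rightarrow> 'b::{banach, second_countable_topology}"
  assumes "f \<in> borel_measurable borel" "\<And>x. x \<in> {\<alpha>..\<beta>} \<Longrightarrow> norm (f x) \<le> B"
  shows "integrable \<mu> f"
  by (rule integrable_const_bound[of _ B]) (use assms concentrated in \<open>auto elim: AE_mp\<close>)

lemma integrable_continuous:
  fixes f :: "real \<Rightarrow> 'b::{banach, second_countable_topology}"
  assumes "f \<in> borel_measurable borel" "continuous_on {\<alpha>..\<beta>} f"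
  shows "integrable \<mu> f"
proof -
  have "bounded (f ` {\<alpha>..\<beta>})"
    using assms(2) compact_continuous_image compact_imp_bounded by blast
  then obtain B where "\<And>x. x \<in> {\<alpha>..\<beta>} \<Longrightarrow> norm (f x) \<le> B"
    unfolding bounded_iff by blast
  then show ?thesis using assms(1) integrable_bounded by blast
qed

text \<open>With fewer than m zeros, \<open>sign_polynomial\<close> gives P of degree below m with P
  f \<ge> 0. As its integral vanishes, P f = 0 almost everywhere, and the measure would live on a
  finite set.\<close>

lemma orthogonal_imp_zeros:
  fixes f :: "real \<Rightarrow> real"
  assumes meas: "f \<in> borel_measurable borel" and cont: "continuous_on {\<alpha>..\<beta>} f"
    and orth: "\<And>P. degree P < m \<Longrightarrow> (LINT x|\<mu>. poly P x * f x) = 0"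
  obtains Y where "finite Y" "card Y = m" "Y \<subseteq> {\<alpha><..<\<beta>}" "\<And>y. y \<in> Y \<Longrightarrow> f y = 0"
proof -
  define Z where "Z = {x\<in>{\<alpha><..<\<beta>}. f x = 0}"
  have "\<exists>Y\<subseteq>Z. finite Y \<and> card Y = m"
  proof (cases "finite Z")
    case False
    then show ?thesis by (meson infinite_arbitrarily_large)
  next
    case True
    have "\<not> card Z < m"
    proof
      assume "card Z < m"
      have "continuous_on {\<alpha><..<\<beta>} f" using cont by (rule continuous_on_subset) auto
      then obtain P where P: "degree P \<le> card Z" "\<And>x. poly P x = 0 \<Longrightarrow> x \<in> Z"
        "\<And>x. x \<in> {\<alpha><..<\<beta>} \<Longrightarrow> 0 \<le> poly P x * f x"
        using sign_polynomial[of \<alpha> \<beta> f] True by (auto simp: Z_def)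
      have cont': "continuous_on {\<alpha>..\<beta>} (\<lambda>x. poly P x * f x)"
        using cont by (intro continuous_intros)
      \<comment> \<open>The sign is known on the open interval only, but the measure may charge the
        endpoints.\<close>
      have nn: "0 \<le> poly P x * f x" if "x \<in> {\<alpha>..\<beta>}" for x
        using continuous_ge_on_closure[of "{\<alpha><..<\<beta>}" "\<lambda>x. poly P x * f x" x 0] cont' that P(3) less
        by (simp add: closure_greaterThanLessThan)
      have int: "integrable \<mu> (\<lambda>x. poly P x * f x)"
        using meas by (intro integrable_continuous cont') measurable
      have "AE x in \<mu>. 0 \<le> poly P x * f x"
        using concentrated nn by (auto elim: AE_mp)
      moreover have "(LINT x|\<mu>. poly P x * f x) = 0"
        using orth P(1) \<open>card Z < m\<close> by simp
      ultimately have "AE x in \<mu>. poly P x * f x = 0"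
        using integral_nonneg_eq_0_iff_AE[OF int] by blast
      \<comment> \<open>f may vanish at the endpoints, which Z leaves out.\<close>
      then have "AE x in \<mu>. x \<in> Z \<union> {\<alpha>, \<beta>}"
        using concentrated
      proof eventually_elim
        case (elim x)
        then show ?case using P(2)[of x] by (auto simp: Z_def)
      qed
      then show False using not_finite[of "Z \<union> {\<alpha>, \<beta>}"] True by simp
    qed
    then show ?thesis
      by (meson True not_less obtain_subset_with_card_n)
  qed
  then show ?thesis using that unfolding Z_def by blast
qed

end

section \<open>Cauchy transforms and their zeros\<close>

context interval_measure
begin

lemma integrable_mult_continuous:
  fixes g h :: "real \<Rightarrow> 'b::{banach, second_countable_topology, real_normed_algebra}"
  assumes "g \<in> borel_measurable borel" "\<And>x. x \<in> {\<alpha>..\<beta>} \<Longrightarrow> norm (g x) \<le> B"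
    and "h \<in> borel_measurable borel" "continuous_on {\<alpha>..\<beta>} h"
  shows "integrable \<mu> (\<lambda>x. h x * g x)"
proof -
  have "bounded (h ` {\<alpha>..\<beta>})"
    using assms(4) compact_continuous_image compact_imp_bounded by blast
  then obtain C where C: "\<And>x. x \<in> {\<alpha>..\<beta>} \<Longrightarrow> norm (h x) \<le> C"
    unfolding bounded_iff by blast
  have "norm (h x * g x) \<le> C * B" if "x \<in> {\<alpha>..\<beta>}" for x
    using norm_mult_ineq[of "h x" "g x"] mult_mono[OF C[OF that] assms(2)[OF that]]
      norm_ge_zero[of "h x"] norm_ge_zero[of "g x"] C[OF that] by linarith
  then show ?thesis using assms by (intro integrable_bounded) measurable
qed

end

text \<open>T is kept apart from g so that roots can be added to it one at a time, each raising N by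
  one.\<close>

definition annihilates :: "real measure \<Rightarrow> (real \<Rightarrow> complex) \<Rightarrow> complex poly \<Rightarrow> nat \<Rightarrow> bool" where
  "annihilates \<mu> g T N \<longleftrightarrow>
    (\<forall>P. degree P < N \<longrightarrow> (LINT x|\<mu>. poly P (of_real x) / poly T (of_real x) * g x) = 0)"

locale cauchy_transform = interval_measure +
  fixes g :: "real \<Rightarrow> complex" and B :: real
  assumes measurable_density [measurable]: "g \<in> borel_measurable borel"
    and bounded_density: "x \<in> {\<alpha>..\<beta>} \<Longrightarrow> norm (g x) \<le> B"
begin

lemma integrable_power:
  assumes "z \<notin> complex_of_real ` {\<alpha>..\<beta>}"
  shows "integrable \<mu> (\<lambda>x. g x / (z - of_real x) ^ k)"
proof -
  have "integrable \<mu> (\<lambda>x. 1 / (z - of_real x) ^ k * g x)"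
    using assms by (intro integrable_mult_continuous[OF _ bounded_density] continuous_intros) auto
  then show ?thesis by simp
qed

text \<open>Direct estimate: the error of the linear approximation is (w - z)^2 times the integral
  of g / ((w - x) (z - x)^2), whose kernel is bounded near z.\<close>

lemma has_field_derivative_cauchy:
  assumes z: "z \<notin> complex_of_real ` {\<alpha>..\<beta>}"
  shows "((\<lambda>w. LINT x|\<mu>. g x / (w - of_real x)) has_field_derivative
    - (LINT x|\<mu>. g x / (z - of_real x) ^ 2)) (at z)"
proof -
  let ?C = "\<lambda>w. LINT x|\<mu>. g x / (w - of_real x)"
  let ?D = "LINT x|\<mu>. g x / (z - of_real x) ^ 2"
  define K where "K = complex_of_real ` {\<alpha>..\<beta>}"
  have "compact K" unfolding K_def by (intro compact_continuous_image continuous_intros) auto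
  then have "open (- K)" by (simp add: compact_imp_closed open_Compl)
  then obtain e where e: "e > 0" "ball z e \<subseteq> - K"
    using z open_contains_ball unfolding K_def by blast
  have dist: "e \<le> norm (z - of_real x)" if "x \<in> {\<alpha>..\<beta>}" for x
    using e that unfolding K_def by (force simp: dist_norm not_less)
  \<comment> \<open>On \<open>ball z (e / 2)\<close> one has |w - x| \<ge> e / 2 and |z - x| \<ge>
    e, so the kernel is at most B / ((e / 2) e^2).\<close>
  define A where "A = 2 * B / e ^ 3 * measure \<mu> (space \<mu>)"
  have bound: "norm (?C w - ?C z + (w - z) * ?D) \<le> A * norm (w - z) ^ 2" if w: "w \<in> ball z (e / 2)" for w
  proof -
    have wK: "w \<notin> complex_of_real ` {\<alpha>..\<beta>}"
    proof -
      have "w \<in> ball z e" using w zero_le_dist[of z w] unfolding mem_ball by linarith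
      then show ?thesis using e by (auto simp: K_def)
    qed
    have dw: "e / 2 \<le> norm (w - of_real x)" if "x \<in> {\<alpha>..\<beta>}" for x
      using dist[OF that] w norm_triangle_ineq[of "z - w" "w - of_real x"] by (simp add: dist_norm)
    have nz: "z - of_real x \<noteq> 0" "w - of_real x \<noteq> 0" if "x \<in> {\<alpha>..\<beta>}" for x
      using z wK that by auto
    let ?h = "\<lambda>x. g x / (w - of_real x) - g x / (z - of_real x) + (w - z) * (g x / (z - of_real x) ^ 2)"
    have eq: "?h x = (w - z) ^ 2 * g x / ((w - of_real x) * (z - of_real x) ^ 2)"
      if "x \<in> {\<alpha>..\<beta>}" for x
    proof -
      define s t where "s = w - of_real x" and "t = z - of_real x"
      have "w - z = s - t" "s \<noteq> 0" "t \<noteq> 0" using nz[OF that] by (simp_all add: s_def t_def)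
      then show ?thesis unfolding s_def[symmetric] t_def[symmetric] \<open>w - z = s - t\<close>
        by (simp add: field_simps power2_eq_square)
    qed
    have hB: "norm (?h x) \<le> 2 * B / e ^ 3 * norm (w - z) ^ 2" if x: "x \<in> {\<alpha>..\<beta>}" for x
    proof -
      have "e / 2 * e ^ 2 \<le> norm (w - of_real x) * norm (z - of_real x) ^ 2"
        using dist[OF x] dw[OF x] e by (intro mult_mono power_mono) auto
      moreover have "0 \<le> B" using bounded_density[OF x] norm_ge_zero[of "g x"] by linarith
      ultimately have "norm (w - z) ^ 2 * norm (g x) / (norm (w - of_real x) * norm (z - of_real x) ^ 2)
          \<le> norm (w - z) ^ 2 * B / (e / 2 * e ^ 2)"
        using bounded_density[OF x] e by (intro frac_le mult_left_mono) auto
      also have "\<dots> = 2 * B / e ^ 3 * norm (w - z) ^ 2"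
        by (simp add: power2_eq_square power3_eq_cube mult_ac)
      finally show ?thesis unfolding eq[OF x] by (simp add: norm_mult norm_divide norm_power)
    qed
    have int: "integrable \<mu> (\<lambda>x. g x / (w - of_real x))" "integrable \<mu> (\<lambda>x. g x / (z - of_real x))"
      "integrable \<mu> (\<lambda>x. (w - z) * (g x / (z - of_real x) ^ 2))"
      using integrable_power[OF wK, of 1] integrable_power[OF z, of 1]
        integrable_mult_right[OF integrable_power[OF z, of 2]] by simp_all
    have "?C w - ?C z + (w - z) * ?D = (LINT x|\<mu>. ?h x)"
      unfolding Bochner_Integration.integral_add[OF Bochner_Integration.integrable_diff[OF int(1,2)] int(3)]
        Bochner_Integration.integral_diff[OF int(1,2)] integral_mult_right_zero ..
    also have "norm \<dots> \<le> (LINT x|\<mu>. 2 * B / e ^ 3 * norm (w - z) ^ 2)"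
    proof (rule order_trans[OF integral_norm_bound integral_mono_AE])
      show "integrable \<mu> (\<lambda>x. norm (?h x))" using int by (intro integrable_norm) auto
      show "AE x in \<mu>. norm (?h x) \<le> 2 * B / e ^ 3 * norm (w - z) ^ 2"
        using concentrated by eventually_elim (rule hB)
    qed auto
    finally show ?thesis by (simp add: A_def mult_ac)
  qed
  have "((\<lambda>w. (?C w - ?C z) / (w - z) + ?D) \<longlongrightarrow> 0) (at z)"
  proof (rule Lim_null_comparison)
    have "norm ((?C w - ?C z) / (w - z) + ?D) \<le> A * norm (w - z)" if "w \<in> ball z (e / 2)" "w \<noteq> z" for w
    proof -
      have "(?C w - ?C z) / (w - z) + ?D = (?C w - ?C z + (w - z) * ?D) / (w - z)"
        using that by (simp add: field_simps)
      also have "norm \<dots> \<le> A * norm (w - z) ^ 2 / norm (w - z)"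
        unfolding norm_divide using bound[OF that(1)] by (intro divide_right_mono) auto
      finally show ?thesis using that by (simp add: power2_eq_square)
    qed
    then show "\<forall>\<^sub>F w in at z. norm ((?C w - ?C z) / (w - z) + ?D) \<le> A * norm (w - z)"
      using e by (intro eventually_at[THEN iffD2] exI[of _ "e / 2"]) (auto simp: dist_commute)
    show "((\<lambda>w. A * norm (w - z)) \<longlongrightarrow> 0) (at z)"
      by (auto intro!: tendsto_eq_intros)
  qed
  then show ?thesis
    unfolding has_field_derivative_iff by (simp add: LIM_zero_iff[of _ "- ?D", symmetric])
qed

lemma integrable_rational:
  assumes "\<And>x. x \<in> {\<alpha>..\<beta>} \<Longrightarrow> poly T (of_real x) \<noteq> 0"
  shows "integrable \<mu> (\<lambda>x. poly P (of_real x) / poly T (of_real x) * g x)"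
  using assms by (intro integrable_mult_continuous[OF _ bounded_density] continuous_intros) auto

lemma annihilates_times_root:
  assumes T: "T = [:-z, 1:] ^ e * T1" and nz: "poly T1 z \<noteq> 0" and deg: "degree T1 \<le> N"
    and z: "z \<notin> complex_of_real ` {\<alpha>..\<beta>}" and T0: "\<And>x. x \<in> {\<alpha>..\<beta>} \<Longrightarrow> poly T (of_real x) \<noteq> 0"
    and ann: "annihilates \<mu> g T N" and zero: "(LINT x|\<mu>. g x / (z - of_real x) ^ Suc e) = 0"
  shows "annihilates \<mu> g ([:-z, 1:] * T) (Suc N)"
proof -
  have split: "\<exists>R. P = [:poly P z:] + [:-z, 1:] * R \<and> (R = 0 \<or> degree P = Suc (degree R))" for P
  proof -
    have "poly (P - [:poly P z:]) z = 0" by simp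
    then obtain R where R: "P - [:poly P z:] = [:-z, 1:] * R" by (metis poly_eq_0_iff_dvd dvdE)
    then have "P = [:poly P z:] + [:-z, 1:] * R" by (simp add: algebra_simps)
    moreover have "degree P = Suc (degree R)" if "R \<noteq> 0"
    proof -
      have "degree ([:-z, 1:] * R) = Suc (degree R)" using that by (subst degree_mult_eq) auto
      then have "degree ([:poly P z:] + [:-z, 1:] * R) = Suc (degree R)"
        by (subst degree_add_eq_right) auto
      then show ?thesis using \<open>P = _\<close> by simp
    qed
    ultimately show ?thesis by blast
  qed
  \<comment> \<open>The case R = 0 is separate because N may be 0, and then
    \<open>degree 0 < N\<close> fails.\<close>
  have low: "(LINT x|\<mu>. poly R (of_real x) / poly T (of_real x) * g x) = 0" if "R = 0 \<or> degree R < N" for R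
    using that ann by (auto simp: annihilates_def)
  let ?f = "\<lambda>x. 1 / poly ([:-z, 1:] * T) (of_real x) * g x"
  have T0': "poly ([:-z, 1:] * T) (of_real x) \<noteq> 0" if "x \<in> {\<alpha>..\<beta>}" for x
    using T0[OF that] z that by auto
  \<comment> \<open>Since T1 - T1(z) = (x - z) R, the function 1 / ((x - z) T) is a combination of
    1 / (x - z)^(e + 1) and R / T.\<close>
  have base: "(LINT x|\<mu>. ?f x) = 0"
  proof -
    obtain R where R: "T1 = [:poly T1 z:] + [:-z, 1:] * R" "R = 0 \<or> degree T1 = Suc (degree R)"
      using split by blast
    let ?c = "(-1) ^ Suc e / poly T1 z"
    have "(LINT x|\<mu>. ?f x) = (LINT x|\<mu>. ?c * (g x / (z - of_real x) ^ Suc e)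
        - 1 / poly T1 z * (poly R (of_real x) / poly T (of_real x) * g x))"
    proof (rule integral_cong_AE)
      show "AE x in \<mu>. ?f x = ?c * (g x / (z - of_real x) ^ Suc e)
        - 1 / poly T1 z * (poly R (of_real x) / poly T (of_real x) * g x)"
        using concentrated
      proof eventually_elim
        case (elim x)
        define t where "t = of_real x - z"
        have t: "t \<noteq> 0" using z elim by (auto simp: t_def)
        define u where "u = poly T1 (of_real x)"
        have u: "u \<noteq> 0" using T0[OF elim] T by (auto simp: u_def)
        have uR: "u = poly T1 z + t * poly R (of_real x)"
          unfolding u_def by (subst R(1)) (simp add: t_def algebra_simps)
        have s: "(z - of_real x) ^ Suc e = (-1) ^ Suc e * t ^ Suc e"
          unfolding power_mult_distrib[symmetric] t_def by simp
        have "1 / (t * (t ^ e * u)) = 1 / (poly T1 z * t ^ Suc e) - 1 / poly T1 z * (poly R (of_real x) / (t ^ e * u))"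
        proof -
          have "1 / (poly T1 z * t ^ Suc e) - 1 / poly T1 z * (poly R (of_real x) / (t ^ e * u))
            = (u - t * poly R (of_real x)) / (poly T1 z * t ^ Suc e * u)"
            using t u nz by (simp add: field_simps)
          also have "\<dots> = 1 / (t * (t ^ e * u))"
            using t u nz by (simp add: uR)
          finally show ?thesis by simp
        qed
        then have "1 / (t * (t ^ e * u)) * g x = (1 / (poly T1 z * t ^ Suc e)
            - 1 / poly T1 z * (poly R (of_real x) / (t ^ e * u))) * g x"
          by (rule arg_cong)
        then have "1 / (t * (t ^ e * u)) * g x = g x / (poly T1 z * t ^ Suc e)
            - 1 / poly T1 z * (poly R (of_real x) / (t ^ e * u) * g x)"
          by (simp only: left_diff_distrib mult.assoc times_divide_eq_left mult_1)
        moreover have "?c * (g x / ((-1) ^ Suc e * t ^ Suc e)) = g x / (poly T1 z * t ^ Suc e)"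
          by simp
        moreover have "poly T (of_real x) = t ^ e * u"
          by (simp add: T t_def u_def)
        moreover have "poly ([:-z, 1:] * T) (of_real x) = t * (t ^ e * u)"
          by (simp add: T t_def u_def algebra_simps)
        ultimately show ?case
          unfolding s by simp
      qed
    qed measurable
    also have "\<dots> = ?c * (LINT x|\<mu>. g x / (z - of_real x) ^ Suc e)
        - 1 / poly T1 z * (LINT x|\<mu>. poly R (of_real x) / poly T (of_real x) * g x)"
      using integrable_power[OF z, of "Suc e"] integrable_rational[OF T0, of R]
      by (subst Bochner_Integration.integral_diff)
        (simp_all only: integrable_mult_right integral_mult_right_zero)
    also have "\<dots> = 0"
      using zero low[of R] R(2) deg by auto
    finally show ?thesis .
  qed
  show ?thesis unfolding annihilates_def
  proof (intro allI impI)
    fix P :: "complex poly" assume P: "degree P < Suc N"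
    obtain R where R: "P = [:poly P z:] + [:-z, 1:] * R" "R = 0 \<or> degree P = Suc (degree R)"
      using split by blast
    have "(LINT x|\<mu>. poly P (of_real x) / poly ([:-z, 1:] * T) (of_real x) * g x)
      = (LINT x|\<mu>. poly P z * ?f x + poly R (of_real x) / poly T (of_real x) * g x)"
    proof (rule integral_cong_AE)
      show "AE x in \<mu>. poly P (of_real x) / poly ([:-z, 1:] * T) (of_real x) * g x
          = poly P z * ?f x + poly R (of_real x) / poly T (of_real x) * g x"
        using concentrated
      proof eventually_elim
        case (elim x)
        define t where "t = of_real x - z"
        have t: "t \<noteq> 0" using z elim by (auto simp: t_def)
        have u: "poly P (of_real x) = poly P z + t * poly R (of_real x)"
          by (subst R(1)) (simp add: t_def algebra_simps)
        have v: "poly ([:-z, 1:] * T) (of_real x) = t * poly T (of_real x)"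
          by (simp add: t_def algebra_simps)
        show ?case unfolding u v using t T0[OF elim] by (simp add: field_simps)
      qed
    qed measurable
    also have "\<dots> = poly P z * (LINT x|\<mu>. ?f x) + (LINT x|\<mu>. poly R (of_real x) / poly T (of_real x) * g x)"
      using integrable_rational[OF T0', of 1] integrable_rational[OF T0, of R]
      by (subst Bochner_Integration.integral_add)
        (simp_all only: integrable_mult_right integral_mult_right_zero poly_1)
    also have "\<dots> = 0" using base low[of R] R(2) P by auto
    finally show "(LINT x|\<mu>. poly P (of_real x) / poly ([:-z, 1:] * T) (of_real x) * g x) = 0" .
  qed
qed

text \<open>Every zero of the transform off the interval buys one further orthogonality
  condition.\<close>

lemma annihilates_prod_roots:
  assumes "finite A" "A \<inter> complex_of_real ` {\<alpha>..\<beta>} = {}" "annihilates \<mu> g 1 m"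
    and "\<And>z. z \<in> A \<Longrightarrow> (LINT x|\<mu>. g x / (z - of_real x)) = 0"
  shows "annihilates \<mu> g (\<Prod>z\<in>A. [:-z, 1:]) (m + card A)"
  using assms
proof (induction A)
  case (insert z A)
  have "annihilates \<mu> g ([:-z, 1:] * (\<Prod>z\<in>A. [:-z, 1:])) (Suc (m + card A))"
  proof (rule annihilates_times_root[where e = 0])
    show "poly (\<Prod>z\<in>A. [:-z, 1:]) z \<noteq> 0"
      using insert by (simp add: poly_prod)
    show "degree (\<Prod>z\<in>A. [:-z, 1:]) \<le> m + card A"
      by (simp add: degree_prod_sum_eq)
    show "poly (\<Prod>z\<in>A. [:-z, 1:]) (of_real x) \<noteq> 0" if "x \<in> {\<alpha>..\<beta>}" for x
      using insert that by (auto simp: poly_prod)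
  qed (use insert in auto)
  then show ?case using insert by simp
qed simp

text \<open>A contradiction needs only one surplus condition, so a single root is doubled; the
  cofactor T1 is the product over the other roots.\<close>

lemma annihilates_double_root:
  assumes "finite A" "A \<inter> complex_of_real ` {\<alpha>..\<beta>} = {}" "annihilates \<mu> g 1 m"
    and "\<And>z. z \<in> A \<Longrightarrow> (LINT x|\<mu>. g x / (z - of_real x)) = 0"
    and "w \<in> A" "(LINT x|\<mu>. g x / (w - of_real x) ^ 2) = 0"
  shows "annihilates \<mu> g ([:-w, 1:] * (\<Prod>z\<in>A. [:-z, 1:])) (Suc (m + card A))"
proof (rule annihilates_times_root[where e = 1])
  show "(\<Prod>z\<in>A. [:-z, 1:]) = [:-w, 1:] ^ 1 * (\<Prod>z\<in>A - {w}. [:-z, 1:])"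
    using assms by (simp add: prod.remove)
  show "poly (\<Prod>z\<in>A - {w}. [:-z, 1:]) w \<noteq> 0"
    using assms by (simp add: poly_prod)
  show "degree (\<Prod>z\<in>A - {w}. [:-z, 1:]) \<le> m + card A"
    using assms by (simp add: degree_prod_sum_eq)
  show "poly (\<Prod>z\<in>A. [:-z, 1:]) (of_real x) \<noteq> 0" if "x \<in> {\<alpha>..\<beta>}" for x
    using assms that by (auto simp: poly_prod)
qed (use assms annihilates_prod_roots in \<open>auto simp: numeral_2_eq_2\<close>)

end

section \<open>Nikishin systems on the real line\<close>

lemma borel_measurable_cauchy_integral:
  fixes h :: "'a::{real_normed_field, second_countable_topology, banach} \<Rightarrow> 'a"
  assumes "finite_measure \<mu>" and [measurable_cong]: "sets \<mu> = sets borel"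
    and [measurable]: "h \<in> borel_measurable borel"
  shows "(\<lambda>y. LINT x|\<mu>. h x / (y - x)) \<in> borel_measurable borel"
proof -
  interpret finite_measure \<mu> by fact
  show ?thesis by (rule borel_measurable_lebesgue_integral) measurable
qed

lemma borel_measurable_cauchy_integral':
  fixes h :: "'a::{real_normed_field, second_countable_topology, banach} \<Rightarrow> 'a"
  assumes "finite_measure \<mu>" and [measurable_cong]: "sets \<mu> = sets borel"
    and [measurable]: "h \<in> borel_measurable borel"
  shows "(\<lambda>y. LINT x|\<mu>. h x / (x - y)) \<in> borel_measurable borel"
proof -
  interpret finite_measure \<mu> by fact
  show ?thesis by (rule borel_measurable_lebesgue_integral) measurable
qed

lemma continuous_on_compact_bounded:
  fixes h :: "'a::topological_space \<Rightarrow> 'b::real_normed_vector"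
  assumes "continuous_on S h" "compact S"
  obtains B where "\<And>x. x \<in> S \<Longrightarrow> norm (h x) \<le> B"
  using compact_imp_bounded[OF compact_continuous_image[OF assms]] unfolding bounded_iff by blast

context interval_measure
begin

lemma cauchy_transform_of_real:
  fixes h :: "real \<Rightarrow> real"
  assumes "h \<in> borel_measurable borel" "continuous_on {\<alpha>..\<beta>} h"
  obtains B where "cauchy_transform \<mu> \<alpha> \<beta> (\<lambda>x. complex_of_real (h x)) B"
proof -
  obtain B where "\<And>x. x \<in> {\<alpha>..\<beta>} \<Longrightarrow> norm (h x) \<le> B"
    using continuous_on_compact_bounded[OF assms(2)] by blast
  then have "cauchy_transform \<mu> \<alpha> \<beta> (\<lambda>x. complex_of_real (h x)) B"
    using assms by unfold_locales auto
  then show ?thesis by (rule that)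
qed

lemma of_real_cauchy_integral:
  "complex_of_real (LINT x|\<mu>. h x / (y - x)) = (LINT x|\<mu>. of_real (h x) / (of_real y - of_real x))"
proof -
  have "(LINT x|\<mu>. complex_of_real (h x) / (of_real y - of_real x)) = (LINT x|\<mu>. of_real (h x / (y - x)))"
    by simp
  then show ?thesis by (simp only: integral_complex_of_real)
qed

text \<open>Complex differentiability off the interval, restricted to the real axis.\<close>

lemma continuous_on_cauchy_integral:
  assumes "h \<in> borel_measurable borel" "continuous_on {\<alpha>..\<beta>} h"
  shows "continuous_on (- {\<alpha>..\<beta>}) (\<lambda>y. LINT x|\<mu>. h x / (y - x))"
proof -
  obtain B where "cauchy_transform \<mu> \<alpha> \<beta> (\<lambda>x. complex_of_real (h x)) B"
    using cauchy_transform_of_real[OF assms] .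
  then interpret cauchy_transform \<mu> \<alpha> \<beta> "\<lambda>x. complex_of_real (h x)" B .
  let ?C = "\<lambda>w. LINT x|\<mu>. complex_of_real (h x) / (w - of_real x)"
  have "continuous_on (- complex_of_real ` {\<alpha>..\<beta>}) ?C"
    by (rule DERIV_continuous_on) (blast intro: has_field_derivative_at_within has_field_derivative_cauchy)
  then have "continuous_on (- {\<alpha>..\<beta>}) (\<lambda>y. Re (?C (of_real y)))"
    by (intro continuous_intros continuous_on_compose2[of _ ?C _ complex_of_real]) auto
  moreover have "Re (?C (of_real y)) = (LINT x|\<mu>. h x / (y - x))" for y
    unfolding of_real_cauchy_integral[symmetric] by simp
  ultimately show ?thesis by simp
qed

text \<open>Disjoint compact intervals have positive distance, so the kernel is bounded almost
  everywhere with respect to a finite product measure.\<close>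

lemma fubini_kernel:
  fixes \<phi> \<psi> :: "real \<Rightarrow> real"
  assumes "interval_measure \<nu> \<gamma> \<delta>" and disj: "{\<alpha>..\<beta>} \<inter> {\<gamma>..\<delta>} = {}"
    and [measurable]: "\<phi> \<in> borel_measurable borel" "\<psi> \<in> borel_measurable borel"
    and cont: "continuous_on {\<alpha>..\<beta>} \<phi>" "continuous_on {\<gamma>..\<delta>} \<psi>"
  shows "(LINT z|\<nu>. \<psi> z * (LINT x|\<mu>. \<phi> x / (z - x))) = (LINT x|\<mu>. \<phi> x * (LINT z|\<nu>. \<psi> z / (z - x)))"
proof -
  interpret N: interval_measure \<nu> \<gamma> \<delta> by fact
  interpret pair_sigma_finite \<mu> \<nu> ..
  interpret P: finite_measure "\<mu> \<Otimes>\<^sub>M \<nu>"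
    by (intro finite_measure_pair_measure) unfold_locales
  obtain B where B: "\<And>x. x \<in> {\<alpha>..\<beta>} \<Longrightarrow> norm (\<phi> x) \<le> B"
    using continuous_on_compact_bounded[OF cont(1)] by blast
  obtain C where C: "\<And>x. x \<in> {\<gamma>..\<delta>} \<Longrightarrow> norm (\<psi> x) \<le> C"
    using continuous_on_compact_bounded[OF cont(2)] by blast
  obtain e where e: "e > 0" "\<And>x z. x \<in> {\<alpha>..\<beta>} \<Longrightarrow> z \<in> {\<gamma>..\<delta>} \<Longrightarrow> e \<le> dist x z"
    using separate_compact_closed[of "{\<alpha>..\<beta>}" "{\<gamma>..\<delta>}"] disj by auto
  let ?H = "\<lambda>x z. \<phi> x * \<psi> z / (z - x)"
  have "AE w in \<mu> \<Otimes>\<^sub>M \<nu>. fst w \<in> {\<alpha>..\<beta>} \<and> snd w \<in> {\<gamma>..\<delta>}"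
  proof (rule AE_pair_measure)
    show "AE x in \<mu>. AE y in \<nu>. fst (x, y) \<in> {\<alpha>..\<beta>} \<and> snd (x, y) \<in> {\<gamma>..\<delta>}"
      using concentrated
    proof eventually_elim
      case (elim x)
      show ?case using N.concentrated by eventually_elim (use elim in simp)
    qed
  qed measurable
  then have "AE w in \<mu> \<Otimes>\<^sub>M \<nu>. norm (case_prod ?H w) \<le> B * C / e"
  proof eventually_elim
    case (elim w)
    obtain x z where w: "w = (x, z)" by force
    then have xz: "x \<in> {\<alpha>..\<beta>}" "z \<in> {\<gamma>..\<delta>}" using elim by auto
    have "norm (\<phi> x) * norm (\<psi> z) / norm (z - x) \<le> B * C / e"
      using B[OF xz(1)] C[OF xz(2)] e(1) e(2)[OF xz] norm_ge_zero[of "\<phi> x"] norm_ge_zero[of "\<psi> z"]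
      by (intro frac_le mult_mono) (auto simp: dist_real_def simp del: norm_ge_zero)
    then show ?case by (simp add: w norm_mult norm_divide abs_mult)
  qed
  then have "integrable (\<mu> \<Otimes>\<^sub>M \<nu>) (case_prod ?H)"
    by (intro P.integrable_const_bound) auto
  then have "(LINT z|\<nu>. LINT x|\<mu>. ?H x z) = (LINT x|\<mu>. LINT z|\<nu>. ?H x z)"
    by (rule Fubini_integral)
  moreover have "(LINT x|\<mu>. ?H x z) = \<psi> z * (LINT x|\<mu>. \<phi> x / (z - x))" for z
    by (subst integral_mult_right_zero[symmetric]) (simp add: mult_ac)
  moreover have "(LINT z|\<nu>. ?H x z) = \<phi> x * (LINT z|\<nu>. \<psi> z / (z - x))" for x
    by (subst integral_mult_right_zero[symmetric]) (simp add: mult_ac)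
  ultimately show ?thesis by simp
qed

end

text \<open>
  In the variable x = t^(p + 1) the function psi_{n,k} becomes second_kind mu r Q k, where r = n mod (p + 1),
  Q is the reduced polynomial, and shift r k distinguishes the two cases in the definition of
  psi_{n,k+1}. On Gamma_k the density of s_{k,k+m} is t^(-m) times reduced_density mu k m at t^(p + 1).
\<close>

definition shift :: "nat \<Rightarrow> nat \<Rightarrow> nat" where
  "shift r k = (if k < r then 1 else 0)"

primrec second_kind :: "(nat \<Rightarrow> real measure) \<Rightarrow> nat \<Rightarrow> real poly \<Rightarrow> nat \<Rightarrow> real \<Rightarrow> real" where
  "second_kind \<mu> r q 0 = poly q"
| "second_kind \<mu> r q (Suc k) =
     (\<lambda>y. y ^ (1 - shift r k) * (LINT x|\<mu> k. second_kind \<mu> r q k x * x ^ shift r k / (y - x)))"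

primrec reduced_density :: "(nat \<Rightarrow> real measure) \<Rightarrow> nat \<Rightarrow> nat \<Rightarrow> real \<Rightarrow> real" where
  "reduced_density \<mu> k 0 = (\<lambda>y. 1)"
| "reduced_density \<mu> k (Suc m) = (\<lambda>y. y * (LINT x|\<mu> (Suc k). reduced_density \<mu> (Suc k) m x / (y - x)))"

text \<open>\<open>zero_notin\<close> ensures that a factor x contributes no zeros inside an
  interval.\<close>

locale nikishin_intervals =
  fixes p :: nat and a b :: "nat \<Rightarrow> real" and \<mu> :: "nat \<Rightarrow> real measure"
  assumes interval: "k < p \<Longrightarrow> interval_measure (\<mu> k) (a k) (b k)"
    and zero_notin: "k < p \<Longrightarrow> 0 \<notin> {a k<..<b k}"
    and disjoint: "Suc k < p \<Longrightarrow> {a k..b k} \<inter> {a (Suc k)..b (Suc k)} = {}"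
begin

lemma finite_measure: "k < p \<Longrightarrow> finite_measure (\<mu> k)"
  and sets_measure: "k < p \<Longrightarrow> sets (\<mu> k) = sets borel"
  using interval[of k] interval_measure.axioms(1) interval_measure.sets_eq by blast+

lemma borel_measurable_second_kind:
  "k \<le> p \<Longrightarrow> second_kind \<mu> r q k \<in> borel_measurable borel"
proof (induction k)
  case (Suc k)
  then have [measurable]: "second_kind \<mu> r q k \<in> borel_measurable borel" by simp
  have [measurable]: "(\<lambda>y. LINT x|\<mu> k. second_kind \<mu> r q k x * x ^ shift r k / (y - x)) \<in> borel_measurable borel"
    using Suc finite_measure sets_measure by (intro borel_measurable_cauchy_integral) auto
  show ?case by simp
qed simp

lemma borel_measurable_reduced_density:
  "k + m < p \<Longrightarrow> reduced_density \<mu> k m \<in> borel_measurable borel"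
proof (induction m arbitrary: k)
  case (Suc m)
  then have [measurable]: "(\<lambda>y. LINT x|\<mu> (Suc k). reduced_density \<mu> (Suc k) m x / (y - x)) \<in> borel_measurable borel"
    using finite_measure sets_measure by (intro borel_measurable_cauchy_integral) auto
  show ?case by simp
qed simp

lemma continuous_on_second_kind: "k < p \<Longrightarrow> continuous_on {a k..b k} (second_kind \<mu> r q k)"
proof (induction k)
  case (Suc k)
  interpret interval_measure "\<mu> k" "a k" "b k" using interval Suc by simp
  have "continuous_on (- {a k..b k}) (\<lambda>y. LINT x|\<mu> k. second_kind \<mu> r q k x * x ^ shift r k / (y - x))"
    using Suc borel_measurable_second_kind[of k r q]
    by (intro continuous_on_cauchy_integral continuous_intros) auto
  then have "continuous_on {a (Suc k)..b (Suc k)}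
      (\<lambda>y. LINT x|\<mu> k. second_kind \<mu> r q k x * x ^ shift r k / (y - x))"
    by (rule continuous_on_subset) (use disjoint[OF Suc(2)] in blast)
  then show ?case by (auto intro!: continuous_intros)
qed (auto intro!: continuous_intros)

lemma continuous_on_reduced_density: "k + m < p \<Longrightarrow> continuous_on {a k..b k} (reduced_density \<mu> k m)"
proof (induction m arbitrary: k)
  case (Suc m)
  interpret interval_measure "\<mu> (Suc k)" "a (Suc k)" "b (Suc k)" using interval Suc by simp
  have "continuous_on (- {a (Suc k)..b (Suc k)}) (\<lambda>y. LINT x|\<mu> (Suc k). reduced_density \<mu> (Suc k) m x / (y - x))"
    using Suc borel_measurable_reduced_density[of "Suc k" m]
    by (intro continuous_on_cauchy_integral) auto
  then have "continuous_on {a k..b k} (\<lambda>y. LINT x|\<mu> (Suc k). reduced_density \<mu> (Suc k) m x / (y - x))"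
    by (rule continuous_on_subset) (use disjoint[of k] Suc(2) in \<open>auto simp: disjoint_iff\<close>)
  then show ?case by (auto intro!: continuous_intros)
qed auto

section \<open>Transfer of the orthogonality conditions to the next level\<close>

definition weighted :: "nat \<Rightarrow> real poly \<Rightarrow> nat \<Rightarrow> real \<Rightarrow> real" where
  "weighted r q k x = second_kind \<mu> r q k x * x ^ shift r k"

lemma borel_measurable_weighted: "k < p \<Longrightarrow> weighted r q k \<in> borel_measurable borel"
  using borel_measurable_second_kind[of k r q] unfolding weighted_def[abs_def] by simp

lemma continuous_on_weighted: "k < p \<Longrightarrow> continuous_on {a k..b k} (weighted r q k)"
  unfolding weighted_def[abs_def] by (intro continuous_intros continuous_on_second_kind)

text \<open>One number \<open>u\<close> encodes a pair: the exponent \<open>u div p\<close> of x and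
  the index \<open>u mod p\<close> of the measure in the Nikishin system. At level \<open>k\<close>
  the indices from \<open>k\<close> on remain, and \<open>u mod p - k\<close> is the length of the
  chain of densities still in front of them.\<close>

definition orthogonal_at :: "nat \<Rightarrow> nat \<Rightarrow> real poly \<Rightarrow> nat \<Rightarrow> bool" where
  "orthogonal_at r D q k \<longleftrightarrow> (\<forall>u\<in>{r..<r + D}. k \<le> u mod p \<longrightarrow>
     (LINT x|\<mu> k. x ^ (u div p) * second_kind \<mu> r q k x * reduced_density \<mu> k (u mod p - k) x) = 0)"

text \<open>For index \<open>k\<close> the density is 1 and the condition is a plain power moment.
  Given r \<le> p, the bound \<open>shift r k \<le> s\<close> says exactly that s p + k is not below
  the start r of the window.\<close>

lemma orthogonal_at_moment:
  assumes "orthogonal_at r D q k" "k < p" "r \<le> p" "shift r k \<le> s" "s * p + k < r + D"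
  shows "(LINT x|\<mu> k. x ^ s * second_kind \<mu> r q k x) = 0"
proof -
  have "r \<le> s * p + k"
  proof (cases "k < r")
    case True
    then have "1 * p \<le> s * p" using assms(4) unfolding shift_def by (intro mult_right_mono) auto
    then show ?thesis using assms(3) by linarith
  qed auto
  then have "s * p + k \<in> {r..<r + D}" using assms(5) by simp
  moreover have "(s * p + k) div p = s" "(s * p + k) mod p = k" using assms(2) by auto
  ultimately show ?thesis
    using assms(1)[unfolded orthogonal_at_def, rule_format, of "s * p + k"] by simp
qed

text \<open>Fubini turns the integral at level \<open>Suc k\<close> into one over
  \<open>\<mu> k\<close> with kernel z^e / (z - x). Replacing z^e by x^e costs a polynomial in x of
  degree below \<open>e\<close>, which the plain moments at level \<open>k\<close> kill; what
  remains is, up to sign, the condition for the same \<open>u\<close> at level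
  \<open>k\<close>.\<close>

lemma orthogonal_at_Suc:
  assumes k: "Suc k < p" and r: "r \<le> p" and orth: "orthogonal_at r D q k"
  shows "orthogonal_at r D q (Suc k)"
  unfolding orthogonal_at_def
proof (intro ballI impI)
  fix u assume u: "u \<in> {r..<r + D}" and ku: "Suc k \<le> u mod p"
  define s j m where "s = u div p" and "j = u mod p" and "m = u mod p - Suc k"
  have j: "j = Suc (k + m)" "j < p" and us: "u = s * p + j"
    using ku k by (auto simp: j_def m_def s_def)
  \<comment> \<open>x^s meets the factor y^(1 - shift) in front of the Cauchy integral in
    \<open>second_kind\<close>. The subtraction is exact since \<open>shift r k\<close> is at most
    1.\<close>
  define e where "e = s + 1 - shift r k"
  have e: "e + shift r k = s + 1" by (auto simp: e_def shift_def)
  interpret M: interval_measure "\<mu> k" "a k" "b k" using interval k by simp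
  interpret N: interval_measure "\<mu> (Suc k)" "a (Suc k)" "b (Suc k)" using interval k by simp
  let ?\<phi> = "weighted r q k" and ?g = "reduced_density \<mu> (Suc k) m"
  have mg: "?g \<in> borel_measurable borel" and cg: "continuous_on {a (Suc k)..b (Suc k)} ?g"
    using j borel_measurable_reduced_density[of "Suc k" m] continuous_on_reduced_density[of "Suc k" m] by auto
  have m\<phi>: "?\<phi> \<in> borel_measurable borel" and c\<phi>: "continuous_on {a k..b k} ?\<phi>"
    using k borel_measurable_weighted continuous_on_weighted by auto
  \<comment> \<open>z - x divides z^e - x^e; the quotient gives the sum.\<close>
  have split: "(LINT z|\<mu> (Suc k). z ^ e * ?g z / (z - x)) = - (x ^ e * (LINT z|\<mu> (Suc k). ?g z / (x - z)))
      + (\<Sum>i<e. x ^ i * (LINT z|\<mu> (Suc k). z ^ (e - Suc i) * ?g z))" if x: "x \<in> {a k..b k}" for x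
  proof -
    have int1: "integrable (\<mu> (Suc k)) (\<lambda>z. z ^ (e - Suc i) * ?g z)" for i
      using mg cg by (intro N.integrable_continuous continuous_intros) auto
    have x': "x \<notin> {a (Suc k)..b (Suc k)}" using x disjoint[OF k] by blast
    have int2: "integrable (\<mu> (Suc k)) (\<lambda>z. ?g z / (x - z))"
      using mg cg x' by (intro N.integrable_continuous continuous_intros) auto
    have "(LINT z|\<mu> (Suc k). z ^ e * ?g z / (z - x)) =
        (LINT z|\<mu> (Suc k). (- (x ^ e)) * (?g z / (x - z)) + (\<Sum>i<e. x ^ i * (z ^ (e - Suc i) * ?g z)))"
    proof (rule integral_cong_AE)
      show "AE z in \<mu> (Suc k). z ^ e * ?g z / (z - x) =
          (- (x ^ e)) * (?g z / (x - z)) + (\<Sum>i<e. x ^ i * (z ^ (e - Suc i) * ?g z))"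
        using N.concentrated
      proof eventually_elim
        case (elim z)
        then have zx: "z - x \<noteq> 0" using x' by auto
        have neg: "c / (x - z) = - (c / (z - x))" for c
          by (metis minus_diff_eq minus_divide_right)
        have "z ^ e = x ^ e + (z - x) * (\<Sum>i<e. x ^ i * z ^ (e - Suc i))"
          using power_diff_sumr2[of z e x] power_diff_sumr2[of x e z] by (simp add: algebra_simps)
        then have "z ^ e * ?g z = x ^ e * ?g z + (z - x) * ((\<Sum>i<e. x ^ i * z ^ (e - Suc i)) * ?g z)"
          by (simp only: distrib_right mult.assoc)
        then have "z ^ e * ?g z / (z - x) = x ^ e * ?g z / (z - x) + (\<Sum>i<e. x ^ i * z ^ (e - Suc i)) * ?g z"
          using zx by (simp only: add_divide_distrib nonzero_mult_div_cancel_left not_False_eq_True)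
        then show ?case
          unfolding neg by (simp add: sum_distrib_right mult.assoc)
      qed
    qed (use mg in measurable)
    also have "\<dots> = (- (x ^ e)) * (LINT z|\<mu> (Suc k). ?g z / (x - z))
        + (\<Sum>i<e. x ^ i * (LINT z|\<mu> (Suc k). z ^ (e - Suc i) * ?g z))"
    proof -
      have int3: "integrable (\<mu> (Suc k)) (\<lambda>z. x ^ i * (z ^ (e - Suc i) * ?g z))" for i
        by (intro integrable_mult_right int1)
      then have int4: "integrable (\<mu> (Suc k)) (\<lambda>z. \<Sum>i<e. x ^ i * (z ^ (e - Suc i) * ?g z))"
        by (rule Bochner_Integration.integrable_sum)
      show ?thesis
        unfolding Bochner_Integration.integral_add[OF integrable_mult_right[OF int2] int4]
          Bochner_Integration.integral_sum[OF int3] integral_mult_right_zero ..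
    qed
    finally show ?thesis by simp
  qed
  \<comment> \<open>x^i times \<open>weighted\<close> is x^(i + shift) times
    \<open>second_kind\<close>, with i + shift \<le> s. As k < j, the index (i + shift) p + k lies
    below u, hence inside the window.\<close>
  have low: "(LINT x|\<mu> k. x ^ i * ?\<phi> x) = 0" if i: "i < e" for i
  proof -
    define s' where "s' = i + shift r k"
    have "s' \<le> s" using i e by (simp add: s'_def)
    have "s' * p \<le> s * p" using \<open>s' \<le> s\<close> by simp
    moreover have "s * p + j < r + D" using u us by simp
    ultimately have "s' * p + k < r + D" using j by linarith
    then have "(LINT x|\<mu> k. x ^ s' * second_kind \<mu> r q k x) = 0"
      using k r orth by (intro orthogonal_at_moment[where D = D]) (auto simp: s'_def)
    then show ?thesis by (simp add: s'_def weighted_def power_add mult_ac)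
  qed
  have "(LINT x|\<mu> (Suc k). x ^ s * second_kind \<mu> r q (Suc k) x * ?g x)
      = (LINT z|\<mu> (Suc k). (z ^ e * ?g z) * (LINT x|\<mu> k. ?\<phi> x / (z - x)))"
    unfolding second_kind.simps weighted_def
    by (intro Bochner_Integration.integral_cong refl)
      (simp add: e_def shift_def)
  also have "\<dots> = (LINT x|\<mu> k. ?\<phi> x * (LINT z|\<mu> (Suc k). z ^ e * ?g z / (z - x)))"
    using mg m\<phi> cg c\<phi> disjoint[OF k]
    by (intro M.fubini_kernel[OF N.interval_measure_axioms] continuous_intros) auto
  also have "\<dots> = (LINT x|\<mu> k. - (x ^ s * second_kind \<mu> r q k x * reduced_density \<mu> k (Suc m) x)
      + (\<Sum>i<e. (x ^ i * ?\<phi> x) * (LINT z|\<mu> (Suc k). z ^ (e - Suc i) * ?g z)))"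
  proof (rule integral_cong_AE)
    show "AE x in \<mu> k. ?\<phi> x * (LINT z|\<mu> (Suc k). z ^ e * ?g z / (z - x)) =
      - (x ^ s * second_kind \<mu> r q k x * reduced_density \<mu> k (Suc m) x)
      + (\<Sum>i<e. (x ^ i * ?\<phi> x) * (LINT z|\<mu> (Suc k). z ^ (e - Suc i) * ?g z))"
      using M.concentrated
    proof eventually_elim
      case (elim x)
      have "?\<phi> x * x ^ e = second_kind \<mu> r q k x * x ^ (e + shift r k)"
        by (simp add: weighted_def power_add)
      then have "?\<phi> x * x ^ e = x ^ s * second_kind \<mu> r q k x * x" unfolding e by simp
      then have main: "?\<phi> x * (x ^ e * (LINT z|\<mu> (Suc k). ?g z / (x - z)))
          = x ^ s * second_kind \<mu> r q k x * reduced_density \<mu> k (Suc m) x"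
        by (simp only: reduced_density.simps mult.assoc[symmetric])
      show ?case
        unfolding split[OF elim] distrib_left sum_distrib_left mult_minus_right main
        by (intro arg_cong2[of _ _ _ _ "(+)"] refl sum.cong) (simp only: mult_ac)
    qed
    show "(\<lambda>x. ?\<phi> x * (LINT z|\<mu> (Suc k). z ^ e * ?g z / (z - x))) \<in> borel_measurable (\<mu> k)"
    proof -
      note m\<phi> [measurable] and mg [measurable]
      have [measurable]: "(\<lambda>x. LINT z|\<mu> (Suc k). z ^ e * ?g z / (z - x)) \<in> borel_measurable borel"
        using finite_measure k sets_measure by (intro borel_measurable_cauchy_integral') auto
      show ?thesis by measurable
    qed
    show "(\<lambda>x. - (x ^ s * second_kind \<mu> r q k x * reduced_density \<mu> k (Suc m) x)
      + (\<Sum>i<e. (x ^ i * ?\<phi> x) * (LINT z|\<mu> (Suc k). z ^ (e - Suc i) * ?g z))) \<in> borel_measurable (\<mu> k)"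
      using m\<phi> borel_measurable_second_kind[of k r q] borel_measurable_reduced_density[of k "Suc m"] j k
      by (simp del: reduced_density.simps)
  qed
  also have "\<dots> = - (LINT x|\<mu> k. x ^ s * second_kind \<mu> r q k x * reduced_density \<mu> k (Suc m) x)
      + (\<Sum>i<e. (LINT x|\<mu> k. x ^ i * ?\<phi> x) * (LINT z|\<mu> (Suc k). z ^ (e - Suc i) * ?g z))"
  proof -
    have "integrable (\<mu> k) (\<lambda>x. x ^ i * ?\<phi> x)" for i
      using m\<phi> c\<phi> by (intro M.integrable_continuous continuous_intros) auto
    moreover have "integrable (\<mu> k) (\<lambda>x. x ^ s * second_kind \<mu> r q k x * reduced_density \<mu> k (Suc m) x)"
      using borel_measurable_second_kind[of k r q] borel_measurable_reduced_density[of k "Suc m"] j k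
        continuous_on_second_kind[of k r q] continuous_on_reduced_density[of k "Suc m"]
      by (intro M.integrable_continuous continuous_intros) (auto simp del: reduced_density.simps)
    ultimately show ?thesis
      by (subst Bochner_Integration.integral_add)
        (auto simp: Bochner_Integration.integral_sum simp del: reduced_density.simps)
  qed
  also have "(LINT x|\<mu> k. x ^ s * second_kind \<mu> r q k x * reduced_density \<mu> k (Suc m) x) = 0"
  proof -
    have "Suc m = u mod p - k" "k \<le> u mod p" using j j_def by auto
    then show ?thesis using orth u unfolding orthogonal_at_def s_def by metis
  qed
  finally show "(LINT x|\<mu> (Suc k). x ^ (u div p) * second_kind \<mu> r q (Suc k) x *
      reduced_density \<mu> (Suc k) (u mod p - Suc k) x) = 0"
    using low by (simp add: s_def m_def)
qed

end

section \<open>Counting zeros\<close>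

declare second_kind.simps(2) [simp del] reduced_density.simps(2) [simp del]

lemma poly_map_poly_of_real:
  "poly (map_poly of_real P) (of_real x :: 'a::{real_algebra_1, comm_semiring_0}) = of_real (poly P x)"
  by (induction P) (auto simp: map_poly_pCons)

lemma degree_map_poly_of_real:
  "degree (map_poly of_real P :: 'a::real_algebra_1 poly) = degree P"
  by (rule degree_map_poly) simp

text \<open>Conjugation permutes the factors.\<close>

lemma poly_prod_roots_real:
  assumes "finite A" "cnj ` A = A"
  shows "poly (\<Prod>z\<in>A. [:-z, 1:]) (complex_of_real x) \<in> \<real>"
proof -
  have "cnj (\<Prod>z\<in>A. complex_of_real x - z) = (\<Prod>z\<in>A. complex_of_real x - cnj z)"
    by (simp add: cnj_prod)
  also have "\<dots> = (\<Prod>z\<in>cnj ` A. complex_of_real x - z)"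
    by (subst prod.reindex) (auto simp: inj_on_def)
  finally show ?thesis
    by (simp add: Reals_cnj_iff assms poly_prod)
qed

text \<open>\<open>q\<close> is any nonzero solution of the \<open>D\<close> conditions, its degree
  left open: the bound \<open>D \<le> degree q\<close> obtained from this is the source of
  normality.\<close>

locale orthogonal_window = nikishin_intervals +
  fixes r D :: nat and q :: "real poly"
  assumes pos: "0 < p" and r_le: "r \<le> p" and nonzero: "q \<noteq> 0"
    and orthogonal: "orthogonal_at r D q 0"
begin

text \<open>The conditions that turn into plain moments at level \<open>k\<close>; for D = d their
  number is M_k.\<close>

definition level_count :: "nat \<Rightarrow> nat" where
  "level_count k = card {u\<in>{r..<r + D}. u mod p = k}"

abbreviation transform :: "nat \<Rightarrow> complex \<Rightarrow> complex" where
  "transform k z \<equiv> LINT x|\<mu> k. complex_of_real (weighted r q k x) / (z - of_real x)"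

abbreviation annihilates_at :: "nat \<Rightarrow> complex poly \<Rightarrow> nat \<Rightarrow> bool" where
  "annihilates_at k \<equiv> annihilates (\<mu> k) (\<lambda>x. complex_of_real (weighted r q k x))"

lemma sum_level_count: "(\<Sum>j<p. level_count j) = D"
proof -
  have "(\<Sum>j<p. level_count j) = card (\<Union>j<p. {u\<in>{r..<r + D}. u mod p = j})"
    unfolding level_count_def by (rule card_UN_disjoint[symmetric]) auto
  also have "(\<Union>j<p. {u\<in>{r..<r + D}. u mod p = j}) = {r..<r + D}"
    using pos by auto
  finally show ?thesis by simp
qed

lemma sum_level_count_split:
  "k < p \<Longrightarrow> (\<Sum>j<k. level_count j) + (level_count k + (\<Sum>j=Suc k..<p. level_count j)) = D"
  using sum_level_count sum.atLeast_Suc_lessThan[of k p level_count]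
    sum.atLeastLessThan_concat[of 0 k p level_count] by (simp add: lessThan_atLeast0)

lemma orthogonal_at_level: "k < p \<Longrightarrow> orthogonal_at r D q k"
  by (induction k) (use orthogonal orthogonal_at_Suc r_le in auto)

text \<open>The u in the window with u mod p = k have quotients from \<open>shift r k\<close> on. If
  the moment of order \<open>s\<close> lay beyond the window, there would be at most
  \<open>s\<close> such u.\<close>

lemma moments:
  assumes k: "k < p" and s: "s < level_count k"
  shows "(LINT x|\<mu> k. x ^ s * weighted r q k x) = 0"
proof -
  define s' where "s' = s + shift r k"
  have "s' * p + k < r + D"
  proof (rule ccontr)
    assume *: "\<not> s' * p + k < r + D"
    have "{u\<in>{r..<r + D}. u mod p = k} \<subseteq> (\<lambda>i. i * p + k) ` {shift r k..<s'}"
    proof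
      fix u assume "u \<in> {u\<in>{r..<r + D}. u mod p = k}"
      then have u: "r \<le> u" "u < r + D" "u = (u div p) * p + k" by auto
      have "u div p < s'"
      proof (rule ccontr)
        assume "\<not> u div p < s'"
        then have "s' * p \<le> (u div p) * p" by simp
        then show False using * u by linarith
      qed
      moreover have "shift r k \<le> u div p"
        using u by (cases "u div p") (auto simp: shift_def)
      ultimately show "u \<in> (\<lambda>i. i * p + k) ` {shift r k..<s'}"
        using u(3) by auto
    qed
    then have "level_count k \<le> card {shift r k..<s'}"
      unfolding level_count_def by (meson card_image_le card_mono finite_atLeastLessThan finite_imageI order_trans)
    then show False using s by (simp add: s'_def)
  qed
  then have "(LINT x|\<mu> k. x ^ s' * second_kind \<mu> r q k x) = 0"
    using k r_le orthogonal_at_level[OF k] by (intro orthogonal_at_moment[where D = D]) (auto simp: s'_def)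
  then show ?thesis by (simp add: s'_def weighted_def power_add mult_ac)
qed

lemma annihilates_at_one:
  assumes k: "k < p"
  shows "annihilates_at k 1 (level_count k)"
  unfolding annihilates_def
proof (intro allI impI)
  fix P :: "complex poly" assume P: "degree P < level_count k"
  interpret interval_measure "\<mu> k" "a k" "b k" using interval k by simp
  have int: "integrable (\<mu> k) (\<lambda>x. complex_of_real (x ^ i * weighted r q k x))" for i
    using borel_measurable_weighted[OF k] continuous_on_weighted[OF k]
    by (intro integrable_continuous continuous_intros) auto
  have "(LINT x|\<mu> k. poly P (of_real x) / poly 1 (of_real x) * complex_of_real (weighted r q k x))
      = (LINT x|\<mu> k. (\<Sum>i\<le>degree P. coeff P i * complex_of_real (x ^ i * weighted r q k x)))"
    by (intro Bochner_Integration.integral_cong refl)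
      (simp add: poly_altdef sum_distrib_left sum_distrib_right mult_ac)
  also have "\<dots> = (\<Sum>i\<le>degree P. coeff P i * (LINT x|\<mu> k. complex_of_real (x ^ i * weighted r q k x)))"
    using Bochner_Integration.integral_sum[OF integrable_mult_right[OF int]]
    by (simp only: integral_mult_right_zero)
  also have "\<dots> = 0"
    using moments[OF k] P by (intro sum.neutral ballI) (simp only: integral_complex_of_real, simp)
  finally show "(LINT x|\<mu> k. poly P (of_real x) / poly 1 (of_real x) * complex_of_real (weighted r q k x)) = 0" .
qed

text \<open>As T is real on the axis, \<open>weighted\<close> divided by T is a real function and
  the sign argument applies. The zeros found lie in the open interval, which omits 0, so they belong
  to \<open>second_kind\<close> and not to the power of x.\<close>

lemma annihilates_imp_zeros:
  assumes k: "k < p" and ann: "annihilates_at k T N"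
    and real: "\<And>x. poly T (complex_of_real x) \<in> \<real>"
    and nz: "\<And>x. x \<in> {a k..b k} \<Longrightarrow> poly T (complex_of_real x) \<noteq> 0"
  obtains Y where "finite Y" "card Y = N" "Y \<subseteq> {a k<..<b k}" "\<And>y. y \<in> Y \<Longrightarrow> second_kind \<mu> r q k y = 0"
proof -
  interpret interval_measure "\<mu> k" "a k" "b k" using interval k by simp
  define t where "t x = Re (poly T (complex_of_real x))" for x
  have t: "complex_of_real (t x) = poly T (complex_of_real x)" for x
    using real by (simp add: t_def)
  have t0: "t x \<noteq> 0" if "x \<in> {a k..b k}" for x
    using nz[OF that] t[of x] by auto
  have mt [measurable]: "t \<in> borel_measurable borel" and ct: "continuous_on {a k..b k} t"
    unfolding t_def[abs_def] by (measurable, intro continuous_intros)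
  let ?f = "\<lambda>x. weighted r q k x / t x"
  have orth: "(LINT x|\<mu> k. poly P x * ?f x) = 0" if "degree P < N" for P
  proof -
    have "complex_of_real (LINT x|\<mu> k. poly P x * ?f x)
      = (LINT x|\<mu> k. poly (map_poly of_real P) (of_real x) / poly T (of_real x) * complex_of_real (weighted r q k x))"
      unfolding integral_complex_of_real[symmetric] by (simp add: poly_map_poly_of_real t)
    also have "\<dots> = 0"
      using ann that by (simp add: annihilates_def degree_map_poly_of_real)
    finally show ?thesis by simp
  qed
  obtain Y where Y: "finite Y" "card Y = N" "Y \<subseteq> {a k<..<b k}" "\<And>y. y \<in> Y \<Longrightarrow> ?f y = 0"
  proof (rule orthogonal_imp_zeros[of ?f N])
    show "?f \<in> borel_measurable borel"
      using borel_measurable_weighted[OF k, of r q] by measurable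
    show "continuous_on {a k..b k} ?f"
      using continuous_on_weighted[OF k] ct t0 by (intro continuous_intros) auto
  qed (use orth in auto)
  have "second_kind \<mu> r q k y = 0" if "y \<in> Y" for y
  proof -
    have "y \<noteq> 0" "y \<in> {a k..b k}" using Y(3) that zero_notin[OF k] by auto
    then show ?thesis using Y(4)[OF that] t0[of y] by (auto simp: weighted_def)
  qed
  then show ?thesis using that Y by blast
qed

lemma of_real_second_kind_Suc:
  assumes "k < p"
  shows "complex_of_real (second_kind \<mu> r q (Suc k) y) = of_real y ^ (1 - shift r k) * transform k (of_real y)"
proof -
  interpret interval_measure "\<mu> k" "a k" "b k" using interval assms by simp
  show ?thesis
    unfolding of_real_cauchy_integral[symmetric] by (simp add: weighted_def second_kind.simps(2))
qed

lemma transform_eq_0: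
  assumes "k < p" "second_kind \<mu> r q (Suc k) y = 0" "y \<noteq> 0"
  shows "transform k (of_real y) = 0"
  using of_real_second_kind_Suc[OF assms(1), of y] assms by simp

lemma annihilates_at_zeros:
  assumes "k < p" "finite A" "A \<inter> complex_of_real ` {a k..b k} = {}" "\<And>z. z \<in> A \<Longrightarrow> transform k z = 0"
  shows "annihilates_at k (\<Prod>z\<in>A. [:-z, 1:]) (level_count k + card A)"
proof -
  interpret interval_measure "\<mu> k" "a k" "b k" using interval assms by simp
  obtain B where "cauchy_transform (\<mu> k) (a k) (b k) (\<lambda>x. complex_of_real (weighted r q k x)) B"
    using cauchy_transform_of_real borel_measurable_weighted continuous_on_weighted assms(1) by metis
  then show ?thesis
    by (rule cauchy_transform.annihilates_prod_roots) (use assms annihilates_at_one in auto)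
qed

text \<open>One step down: the zeros in A become the roots of T, and closure under conjugation makes
  T real on the axis.\<close>

lemma transform_zeros_imp_zeros:
  assumes k: "k < p" and A: "finite A" "A \<inter> complex_of_real ` {a k..b k} = {}" "cnj ` A = A"
    and zero: "\<And>z. z \<in> A \<Longrightarrow> transform k z = 0"
  obtains Y where "finite Y" "card Y = level_count k + card A" "Y \<subseteq> {a k<..<b k}"
    "\<And>y. y \<in> Y \<Longrightarrow> second_kind \<mu> r q k y = 0"
proof (rule annihilates_imp_zeros[OF k annihilates_at_zeros[OF k A(1,2) zero]])
  show "poly (\<Prod>z\<in>A. [:-z, 1:]) (complex_of_real x) \<in> \<real>" for x
    by (rule poly_prod_roots_real[OF A(1,3)])
  show "poly (\<Prod>z\<in>A. [:-z, 1:]) (complex_of_real x) \<noteq> 0" if "x \<in> {a k..b k}" for x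
    using A that by (auto simp: poly_prod)
qed (use that in auto)

lemma real_zeros:
  assumes k: "Suc k < p" and Y: "Y \<subseteq> {a (Suc k)<..<b (Suc k)}" "\<And>y. y \<in> Y \<Longrightarrow> second_kind \<mu> r q (Suc k) y = 0"
  shows "of_real ` Y \<inter> complex_of_real ` {a k..b k} = {}" "cnj ` of_real ` Y = of_real ` Y"
    "\<And>z. z \<in> complex_of_real ` Y \<Longrightarrow> transform k z = 0" "0 \<notin> complex_of_real ` Y"
proof -
  have "{a (Suc k)<..<b (Suc k)} \<subseteq> {a (Suc k)..b (Suc k)}" by auto
  then show "of_real ` Y \<inter> complex_of_real ` {a k..b k} = {}"
    using Y(1) disjoint[OF k] by (auto simp: image_iff)
  show "cnj ` of_real ` Y = of_real ` Y" by (simp add: image_image)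
  have nz: "y \<noteq> 0" if "y \<in> Y" for y using that Y zero_notin[OF k] by auto
  then show "0 \<notin> complex_of_real ` Y" by auto
  show "\<And>z. z \<in> complex_of_real ` Y \<Longrightarrow> transform k z = 0"
    using k Y nz transform_eq_0[of k] by auto
qed

text \<open>On the way down each level j < k adds \<open>level_count j\<close> zeros, and the
  polynomial at the bottom has at most \<open>degree q\<close> of them.\<close>

lemma card_zeros_le_degree:
  assumes "k < p" "finite Y" "Y \<subseteq> {a k<..<b k}" "\<And>y. y \<in> Y \<Longrightarrow> second_kind \<mu> r q k y = 0"
  shows "card Y + (\<Sum>j<k. level_count j) \<le> degree q"
  using assms
proof (induction k arbitrary: Y)
  case 0
  then have "card Y \<le> card {x. poly q x = 0}"
    using poly_roots_finite[OF nonzero] by (intro card_mono) auto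
  then show ?case using card_poly_roots_bound[OF nonzero] by simp
next
  case (Suc k)
  obtain X where X: "finite X" "card X = level_count k + card (complex_of_real ` Y)" "X \<subseteq> {a k<..<b k}"
    "\<And>y. y \<in> X \<Longrightarrow> second_kind \<mu> r q k y = 0"
    using transform_zeros_imp_zeros[of k "of_real ` Y"] real_zeros[OF Suc(2,4,5)] Suc(2,3) by auto
  have "card (complex_of_real ` Y) = card Y" by (intro card_image) (auto simp: inj_on_def)
  then show ?case using Suc.IH[OF _ X(1,3,4)] Suc(2) X(2) by simp
qed

text \<open>The descent starts at level p - 1 with T = 1, where no zeros of a next function are at
  hand; hence the induction on the distance from p.\<close>

lemma exists_zeros:
  assumes "k < p"
  shows "\<exists>Y. finite Y \<and> card Y = (\<Sum>j=k..<p. level_count j) \<and> Y \<subseteq> {a k<..<b k} \<and>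
    (\<forall>y\<in>Y. second_kind \<mu> r q k y = 0)"
  using assms
proof (induction "p - k" arbitrary: k)
    case (Suc d)
    have split: "(\<Sum>j=k..<p. level_count j) = level_count k + (\<Sum>j=Suc k..<p. level_count j)"
      using Suc(3) by (simp add: sum.atLeast_Suc_lessThan)
    show ?case
    proof (cases "Suc k < p")
      case True
      have d: "d = p - Suc k" using Suc(2) by simp
      obtain Y where Y: "finite Y" "card Y = (\<Sum>j=Suc k..<p. level_count j)" "Y \<subseteq> {a (Suc k)<..<b (Suc k)}"
        "\<And>y. y \<in> Y \<Longrightarrow> second_kind \<mu> r q (Suc k) y = 0"
        using Suc(1)[OF d True] by blast
      have cY: "card (complex_of_real ` Y) = card Y" by (intro card_image) (auto simp: inj_on_def)
      obtain X where "finite X" "card X = level_count k + card (complex_of_real ` Y)" "X \<subseteq> {a k<..<b k}"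
        "\<And>y. y \<in> X \<Longrightarrow> second_kind \<mu> r q k y = 0"
      proof (rule transform_zeros_imp_zeros[OF Suc(3) finite_imageI[OF Y(1)] real_zeros(1,2)[OF True Y(3,4)]])
      qed (use real_zeros(3)[OF True Y(3,4)] in auto)
      then show ?thesis using cY Y(2) split by auto
    next
      case False
      obtain X where "finite X" "card X = level_count k + card ({} :: complex set)" "X \<subseteq> {a k<..<b k}"
        "\<And>y. y \<in> X \<Longrightarrow> second_kind \<mu> r q k y = 0"
        by (rule transform_zeros_imp_zeros[OF Suc(3), of "{}"]) auto
      moreover have "(\<Sum>j=Suc k..<p. level_count j) = 0" using False by simp
      ultimately show ?thesis using split by auto
    qed
  qed simp

text \<open>The zeros guaranteed at level 0 number D in all, and they are roots of the nonzero
  polynomial q.\<close>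

lemma le_degree: "D \<le> degree q"
proof -
  obtain Y where Y: "finite Y" "card Y = (\<Sum>j=0..<p. level_count j)" "Y \<subseteq> {a 0<..<b 0}"
    "\<And>y. y \<in> Y \<Longrightarrow> second_kind \<mu> r q 0 y = 0"
    using exists_zeros[OF pos] by blast
  then have "card Y + (\<Sum>j<0. level_count j) \<le> degree q"
    by (intro card_zeros_le_degree pos)
  then show ?thesis using Y(2) sum_level_count by (simp add: lessThan_atLeast0)
qed

end

section \<open>Exact zero counts when the degree equals the number of conditions\<close>

locale orthogonal_window_exact = orthogonal_window +
  assumes degree_eq: "degree q = D"
begin

text \<open>The budget D is tight: the levels up to \<open>k\<close> already spend their own counts,
  so N has to fit into the counts of the later levels.\<close>

lemma annihilates_at_le:
  assumes k: "k < p" and ann: "annihilates_at k T (level_count k + N)"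
    and real: "\<And>x. poly T (complex_of_real x) \<in> \<real>"
    and nz: "\<And>x. x \<in> {a k..b k} \<Longrightarrow> poly T (complex_of_real x) \<noteq> 0"
  shows "N \<le> (\<Sum>j=Suc k..<p. level_count j)"
proof -
  obtain Y where "finite Y" "card Y = level_count k + N" "Y \<subseteq> {a k<..<b k}"
    "\<And>y. y \<in> Y \<Longrightarrow> second_kind \<mu> r q k y = 0"
    using annihilates_imp_zeros[OF assms] by metis
  then show ?thesis
    using card_zeros_le_degree[OF k, of Y] degree_eq sum_level_count_split[OF k] by simp
qed

definition transform_zeros :: "nat \<Rightarrow> complex set" where
  "transform_zeros k = {z. z \<notin> complex_of_real ` {a k..b k} \<and> z \<noteq> 0 \<and> transform k z = 0}"

lemma card_transform_zeros_le:
  assumes k: "k < p" and A: "finite A" "A \<inter> complex_of_real ` {a k..b k} = {}" "cnj ` A = A"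
    and zero: "\<And>z. z \<in> A \<Longrightarrow> transform k z = 0"
  shows "card A \<le> (\<Sum>j=Suc k..<p. level_count j)"
proof (rule annihilates_at_le[OF k annihilates_at_zeros[OF k A(1,2) zero]])
  show "poly (\<Prod>z\<in>A. [:-z, 1:]) (complex_of_real x) \<in> \<real>" for x
    by (rule poly_prod_roots_real[OF A(1,3)])
  show "poly (\<Prod>z\<in>A. [:-z, 1:]) (complex_of_real x) \<noteq> 0" if "x \<in> {a k..b k}" for x
    using A that by (auto simp: poly_prod)
qed

text \<open>The density is real, so non-real zeros come in conjugate pairs.\<close>

lemma transform_cnj: "transform k (cnj z) = cnj (transform k z)"
proof -
  have "transform k (cnj z) = (LINT x|\<mu> k. cnj (complex_of_real (weighted r q k x) / (z - of_real x)))"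
    by simp
  then show ?thesis by (simp only: Bochner_Integration.integral_cnj)
qed

text \<open>Y already attains the maximal number of zeros; a further one, completed by its
  conjugate, would exceed it.\<close>

lemma transform_zeros_eq:
  assumes k: "k < p" and Y: "finite Y" "card Y = (\<Sum>j=Suc k..<p. level_count j)" "0 \<notin> of_real ` Y"
    "of_real ` Y \<inter> complex_of_real ` {a k..b k} = {}" "\<And>z. z \<in> complex_of_real ` Y \<Longrightarrow> transform k z = 0"
  shows "transform_zeros k = of_real ` Y"
proof (rule antisym)
  show "of_real ` Y \<subseteq> transform_zeros k" using Y by (auto simp: transform_zeros_def)
  show "transform_zeros k \<subseteq> of_real ` Y"
  proof (rule ccontr)
    assume "\<not> transform_zeros k \<subseteq> of_real ` Y"
    then obtain z where z: "z \<notin> complex_of_real ` {a k..b k}" "z \<noteq> 0" "transform k z = 0" "z \<notin> of_real ` Y"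
      by (auto simp: transform_zeros_def)
    \<comment> \<open>z may be real, and then only one point is added; one is enough.\<close>
    define A where "A = insert z (insert (cnj z) (of_real ` Y))"
    have cz: "cnj z \<notin> complex_of_real ` {a k..b k}"
    proof
      assume "cnj z \<in> complex_of_real ` {a k..b k}"
      then have "cnj (cnj z) \<in> complex_of_real ` {a k..b k}" by (auto simp del: complex_cnj_cnj)
      then show False using z(1) by simp
    qed
    have "card A \<le> (\<Sum>j=Suc k..<p. level_count j)"
    proof (rule card_transform_zeros_le[OF k])
      show "cnj ` A = A" by (auto simp: A_def image_image)
      show "transform k w = 0" if "w \<in> A" for w
        using that z(3) Y(5) transform_cnj[of k z] unfolding A_def by auto
    qed (use Y z cz in \<open>auto simp: A_def\<close>)
    moreover have "Suc (card Y) \<le> card A"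
    proof -
      have "card (complex_of_real ` Y) = card Y" by (intro card_image) (auto simp: inj_on_def)
      then have "card (insert z (complex_of_real ` Y)) = Suc (card Y)" using Y z by simp
      then show ?thesis using card_mono[of A "insert z (of_real ` Y)"] Y by (auto simp: A_def)
    qed
    ultimately show False using Y(2) by simp
  qed
qed

text \<open>The integral is, up to sign, the derivative of the transform. Were it zero, the root y
  could be doubled, which is one condition more than the budget allows; T stays real because y is
  real.\<close>

lemma transform_zero_simple:
  assumes k: "k < p" and Y: "finite Y" "card Y = (\<Sum>j=Suc k..<p. level_count j)"
    "of_real ` Y \<inter> complex_of_real ` {a k..b k} = {}" "\<And>z. z \<in> complex_of_real ` Y \<Longrightarrow> transform k z = 0"
    and y: "y \<in> Y"
  shows "(LINT x|\<mu> k. complex_of_real (weighted r q k x) / (of_real y - of_real x) ^ 2) \<noteq> 0"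
proof
  assume zero: "(LINT x|\<mu> k. complex_of_real (weighted r q k x) / (of_real y - of_real x) ^ 2) = 0"
  interpret interval_measure "\<mu> k" "a k" "b k" using interval k by simp
  obtain B where "cauchy_transform (\<mu> k) (a k) (b k) (\<lambda>x. complex_of_real (weighted r q k x)) B"
    using cauchy_transform_of_real borel_measurable_weighted continuous_on_weighted k by metis
  then have "annihilates_at k ([:-of_real y, 1:] * (\<Prod>z\<in>of_real ` Y. [:-z, 1:]))
      (Suc (level_count k + card (complex_of_real ` Y)))"
    by (rule cauchy_transform.annihilates_double_root)
      (use Y annihilates_at_one[OF k] y zero in auto)
  then have *: "annihilates_at k ([:-of_real y, 1:] * (\<Prod>z\<in>of_real ` Y. [:-z, 1:]))
      (level_count k + Suc (card (complex_of_real ` Y)))" by simp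
  have "Suc (card (complex_of_real ` Y)) \<le> (\<Sum>j=Suc k..<p. level_count j)"
  proof (rule annihilates_at_le[OF k *])
    fix x
    have "poly (\<Prod>z\<in>of_real ` Y. [:-z, 1:]) (complex_of_real x) \<in> \<real>"
      by (rule poly_prod_roots_real) (use Y in \<open>auto simp: image_image\<close>)
    then show "poly ([:-of_real y, 1:] * (\<Prod>z\<in>of_real ` Y. [:-z, 1:])) (complex_of_real x) \<in> \<real>"
      unfolding poly_mult by (intro Reals_mult) auto
    assume "x \<in> {a k..b k}"
    then have "complex_of_real x \<notin> of_real ` Y" using Y(3) by blast
    then show "poly ([:-of_real y, 1:] * (\<Prod>z\<in>of_real ` Y. [:-z, 1:])) (complex_of_real x) \<noteq> 0"
      using Y(1) y by (auto simp: poly_prod)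
  qed
  moreover have "card (complex_of_real ` Y) = card Y" by (intro card_image) (auto simp: inj_on_def)
  ultimately show False using Y(2) by simp
qed

text \<open>The exponent \<open>e\<close> covers both possible factors z^(1 - c) in psi; away from 0
  such a factor does not change the order of a zero.\<close>

lemma zorder_transform:
  assumes k: "k < p" and z: "z \<notin> complex_of_real ` {a k..b k}" "z \<noteq> 0" "transform k z = 0"
    and nz: "(LINT x|\<mu> k. complex_of_real (weighted r q k x) / (z - of_real x) ^ 2) \<noteq> 0"
  shows "zorder (\<lambda>w. w ^ e * transform k w) z = 1"
proof -
  interpret interval_measure "\<mu> k" "a k" "b k" using interval k by simp
  obtain B where "cauchy_transform (\<mu> k) (a k) (b k) (\<lambda>x. complex_of_real (weighted r q k x)) B"
    using cauchy_transform_of_real borel_measurable_weighted continuous_on_weighted k by metis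
  then interpret cauchy_transform "\<mu> k" "a k" "b k" "\<lambda>x. complex_of_real (weighted r q k x)" B .
  let ?f = "\<lambda>w. w ^ e * transform k w"
  define S where "S = - complex_of_real ` {a k..b k}"
  have "compact (complex_of_real ` {a k..b k})" by (intro compact_continuous_image continuous_intros) auto
  then have "open S" by (simp add: S_def compact_imp_closed open_Compl)
  have "transform k holomorphic_on S"
    unfolding holomorphic_on_def field_differentiable_def S_def
    using has_field_derivative_cauchy has_field_derivative_at_within by blast
  then have hol: "?f holomorphic_on S" by (intro holomorphic_intros)
  have "((\<lambda>w. w ^ e) has_field_derivative of_nat e * z ^ (e - 1)) (at z)"
    by (auto intro!: derivative_eq_intros)
  from DERIV_imp_deriv[OF DERIV_mult[OF this has_field_derivative_cauchy[OF z(1)]]]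
  have "deriv ?f z = of_nat e * z ^ (e - 1) * transform k z
      + - (LINT x|\<mu> k. complex_of_real (weighted r q k x) / (z - of_real x) ^ 2) * z ^ e" .
  then have "deriv ?f z \<noteq> 0" using nz z(2) unfolding z(3) by simp
  then show ?thesis
    using hol \<open>open S\<close> z by (intro zorder_zero_eqI[of _ S]) (auto simp: S_def)
qed

lemma zeros_of_transform:
  assumes k: "k < p"
  shows "finite (transform_zeros k)"
    and "card (transform_zeros k) = (\<Sum>j=Suc k..<p. level_count j)"
    and "z \<in> transform_zeros k \<Longrightarrow> zorder (\<lambda>w. w ^ e * transform k w) z = 1"
    and "Suc k < p \<Longrightarrow> transform_zeros k \<subseteq> of_real ` {a (Suc k)<..<b (Suc k)}"
proof -
  obtain Y where Y: "finite Y" "card Y = (\<Sum>j=Suc k..<p. level_count j)" "0 \<notin> complex_of_real ` Y"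
    "of_real ` Y \<inter> complex_of_real ` {a k..b k} = {}" "\<And>z. z \<in> complex_of_real ` Y \<Longrightarrow> transform k z = 0"
    "Suc k < p \<Longrightarrow> Y \<subseteq> {a (Suc k)<..<b (Suc k)}"
  proof (cases "Suc k < p")
    case True
    obtain Y where Y: "finite Y" "card Y = (\<Sum>j=Suc k..<p. level_count j)" "Y \<subseteq> {a (Suc k)<..<b (Suc k)}"
      "\<And>y. y \<in> Y \<Longrightarrow> second_kind \<mu> r q (Suc k) y = 0"
      using exists_zeros[OF True] by blast
    show thesis
      by (rule that[OF Y(1,2) real_zeros(4,1)[OF True Y(3,4)]])
        (use real_zeros(3)[OF True Y(3,4)] Y(3) in auto)
  next
    case False
    \<comment> \<open>At the last level k = p - 1 the sum is empty, so the empty set has the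
      required cardinality.\<close>
    show thesis by (rule that[of "{}"]) (use False in auto)
  qed
  have eq: "transform_zeros k = of_real ` Y" by (rule transform_zeros_eq[OF k Y(1-5)])
  show "finite (transform_zeros k)" using Y eq by simp
  show "card (transform_zeros k) = (\<Sum>j=Suc k..<p. level_count j)"
    unfolding eq using Y by (subst card_image) (auto simp: inj_on_def)
  show "Suc k < p \<Longrightarrow> transform_zeros k \<subseteq> of_real ` {a (Suc k)<..<b (Suc k)}"
    using eq Y(6) by auto
  show "zorder (\<lambda>w. w ^ e * transform k w) z = 1" if z: "z \<in> transform_zeros k"
  proof -
    obtain y where y: "y \<in> Y" "z = of_real y" using z unfolding eq by blast
    have "z \<notin> complex_of_real ` {a k..b k}" "z \<noteq> 0" "transform k z = 0"
      using z unfolding transform_zeros_def by blast+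
    moreover have "(LINT x|\<mu> k. complex_of_real (weighted r q k x) / (z - of_real x) ^ 2) \<noteq> 0"
      unfolding y(2) by (rule transform_zero_simple[OF k Y(1,2,4,5) y(1)])
    ultimately show ?thesis by (rule zorder_transform[OF k])
  qed
qed

text \<open>D distinct zeros in (a 0, b 0) exhaust the degree D, which leaves no room for other
  zeros or for multiplicity.\<close>

lemma zeros_of_poly:
  defines "Q \<equiv> map_poly complex_of_real q"
  shows "card {z. poly Q z = 0} = (\<Sum>j=0..<p. level_count j)"
    and "{z. poly Q z = 0} \<subseteq> of_real ` {a 0<..<b 0}"
    and "poly Q z = 0 \<Longrightarrow> zorder (poly Q) z = 1"
proof -
  obtain Y where Y: "finite Y" "card Y = (\<Sum>j=0..<p. level_count j)" "Y \<subseteq> {a 0<..<b 0}"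
    "\<And>y. y \<in> Y \<Longrightarrow> second_kind \<mu> r q 0 y = 0"
    using exists_zeros[OF pos] by blast
  have Q: "Q \<noteq> 0" "degree Q = D"
    using nonzero degree_eq by (auto simp: Q_def degree_map_poly_of_real map_poly_eq_0_iff)
  have D: "(\<Sum>j=0..<p. level_count j) = D" using sum_level_count by (simp add: lessThan_atLeast0)
  have cY: "card (complex_of_real ` Y) = D"
    using Y D by (subst card_image) (auto simp: inj_on_def)
  have sub: "of_real ` Y \<subseteq> {z. poly Q z = 0}"
    using Y(4) by (auto simp: Q_def poly_map_poly_of_real)
  have eq: "{z. poly Q z = 0} = of_real ` Y"
    using card_seteq[OF poly_roots_finite[OF Q(1)] sub] card_poly_roots_bound[OF Q(1)] cY Q(2) by simp
  show "card {z. poly Q z = 0} = (\<Sum>j=0..<p. level_count j)" using eq cY D by simp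
  show "{z. poly Q z = 0} \<subseteq> of_real ` {a 0<..<b 0}" using eq Y(3) by auto
  show "zorder (poly Q) z = 1" if z: "poly Q z = 0"
  proof -
    have fin: "finite {z. poly Q z = 0}" by (rule poly_roots_finite[OF Q(1)])
    have ge: "1 \<le> order w Q" if "w \<in> {z. poly Q z = 0}" for w
      using that Q(1) order_root[of Q w] by simp
    have "order z Q = 1"
    proof (rule ccontr)
      assume "order z Q \<noteq> 1"
      then have "1 < order z Q" using ge z by force
      then have "(\<Sum>w | poly Q w = 0. 1) < (\<Sum>w | poly Q w = 0. order w Q)"
        using z ge by (intro sum_strict_mono_ex1[OF fin]) auto
      then show False using sum_order_le_degree[OF Q(1)] Q(2) eq cY by simp
    qed
    then obtain R where R: "Q = [:-z, 1:] * R" "poly R z \<noteq> 0"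
      using order_decomp[OF Q(1), of z] by (auto simp: poly_eq_0_iff_dvd)
    have "(poly Q has_field_derivative poly R z) (at z)"
    proof -
      have "pderiv Q = R + [:-z, 1:] * pderiv R"
        unfolding R(1) by (subst pderiv_mult) (simp add: pderiv_pCons)
      then have "poly (pderiv Q) z = poly R z" by simp
      then show ?thesis by (metis poly_DERIV)
    qed
    then have "deriv (poly Q) z \<noteq> 0" using R(2) by (simp add: DERIV_imp_deriv)
    then show ?thesis
      using z by (intro zorder_zero_eqI[of _ UNIV]) (auto intro!: holomorphic_intros)
  qed
qed

end

section \<open>Rotation invariant measures on stars\<close>

locale star_system =
  fixes p :: nat and a b :: "nat \<Rightarrow> real" and \<sigma> :: "nat \<Rightarrow> complex measure"
  assumes p_pos: "p \<ge> 1"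
    and even_interval: "j < p \<Longrightarrow> even j \<Longrightarrow> 0 \<le> a j \<and> a j < b j"
    and odd_interval: "j < p \<Longrightarrow> odd j \<Longrightarrow> a j < b j \<and> b j \<le> 0"
    and disjoint_stars: "j + 1 < p \<Longrightarrow> star_set p a b j \<inter> star_set p a b (j + 1) = {}"
    and star_measures: "j < p \<Longrightarrow> star_measure p a b j (\<sigma> j)"
begin

declare power_Suc [simp del]

definition \<omega> :: complex where
  "\<omega> = cis (2 * pi / real (p + 1))"

text \<open>The power is real on the star, so taking the real part loses nothing there; it makes the
  image a measure on the real line.\<close>

definition \<mu> :: "nat \<Rightarrow> real measure" where
  "\<mu> k = distr (\<sigma> k) borel (\<lambda>z. Re (z ^ (p + 1)))"

lemma omega_power_eq_1: "\<omega> ^ i = 1 \<longleftrightarrow> (p + 1) dvd i"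
proof -
  have "\<omega> ^ i = exp (of_nat i * (\<i> * of_real (2 * pi / real (p + 1))))"
    unfolding \<omega>_def cis_conv_exp exp_of_nat_mult ..
  also have "\<dots> = exp (2 * of_real pi * \<i> * of_nat i / of_nat (p + 1))" by (simp add: mult_ac)
  finally have "\<omega> ^ i = exp (2 * of_real pi * \<i> * of_nat i / of_nat (p + 1))" .
  then show ?thesis by (simp only: complex_root_unity_eq_1)
qed

lemma omega_power_mult [simp]: "(\<omega> * z) ^ (p + 1) = z ^ (p + 1)" "(\<omega> * z) ^ Suc p = z ^ Suc p"
  using omega_power_eq_1[of "p + 1"] by (auto simp only: power_mult_distrib Suc_eq_plus1 dvd_refl simp_thms mult_1)

lemma omega_nonzero [simp]: "\<omega> \<noteq> 0"
  by (simp add: \<omega>_def)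

lemma sets_sigma [measurable_cong]: "k < p \<Longrightarrow> sets (\<sigma> k) = sets borel"
  and finite_sigma: "k < p \<Longrightarrow> finite_measure (\<sigma> k)"
  using star_measures unfolding star_measure_def by auto

lemma compact_star_set: "compact (star_set p a b k)"
  unfolding compact_eq_bounded_closed
proof
  have K: "compact (complex_of_real ` {a k..b k})"
    by (intro compact_continuous_image continuous_intros) auto
  have "star_set p a b k = (\<lambda>z. z ^ (p + 1)) -` (complex_of_real ` {a k..b k})"
    by (auto simp: star_set_def)
  then show "closed (star_set p a b k)"
    using compact_imp_closed[OF K] by (simp only:) (intro closed_vimage continuous_intros)
  obtain C where C: "\<And>w. w \<in> complex_of_real ` {a k..b k} \<Longrightarrow> norm w \<le> C"
    using compact_imp_bounded[OF K] unfolding bounded_iff by blast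
  have "norm z \<le> max 1 C" if "z \<in> star_set p a b k" for z
  proof (cases "norm z \<le> 1")
    case False
    then have "norm z \<le> norm z ^ (p + 1)" by (intro self_le_power) auto
    also have "\<dots> \<le> C" using C[of "z ^ (p + 1)"] that by (simp add: star_set_def norm_power)
    finally show ?thesis by simp
  qed simp
  then show "bounded (star_set p a b k)" unfolding bounded_iff by blast
qed

lemma AE_star_set: "k < p \<Longrightarrow> AE t in \<sigma> k. t \<in> star_set p a b k"
  using star_measures[of k] compact_imp_closed[OF compact_star_set[of k]]
  unfolding star_measure_def
  by (intro AE_I[of _ _ "- star_set p a b k"]) auto

lemma star_setD:
  assumes "t \<in> star_set p a b k"
  shows "t ^ (p + 1) = of_real (Re (t ^ (p + 1)))" "Re (t ^ (p + 1)) \<in> {a k..b k}"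
  using assms by (auto simp: star_set_def)

lemma finite_star_preimage: "finite F \<Longrightarrow> finite {z::complex. z ^ (p + 1) \<in> complex_of_real ` F}"
proof -
  assume "finite F"
  have "{z::complex. z ^ (p + 1) \<in> complex_of_real ` F} = (\<Union>x\<in>F. {z. z ^ (p + 1) = of_real x})" by auto
  then show ?thesis using \<open>finite F\<close> finite_nth_roots[of "p + 1"] by auto
qed

lemma interval_measure_mu:
  assumes k: "k < p"
  shows "interval_measure (\<mu> k) (a k) (b k)"
proof -
  interpret S: finite_measure "\<sigma> k" by (rule finite_sigma[OF k])
  note sets_sigma[OF k, measurable_cong]
  have m [measurable]: "(\<lambda>z. Re (z ^ (p + 1))) \<in> borel_measurable (\<sigma> k)" by measurable
  interpret finite_measure "\<mu> k"
    unfolding \<mu>_def by (rule S.finite_measure_distr[OF m])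
  show ?thesis
  proof
    show "sets (\<mu> k) = sets borel" by (simp add: \<mu>_def)
    show "a k < b k" using even_interval odd_interval k by (cases "even k") auto
    show "AE x in \<mu> k. x \<in> {a k..b k}"
      unfolding \<mu>_def using AE_star_set[OF k] star_setD(2)
      by (subst AE_distr_iff[OF m]) (auto elim: AE_mp)
    fix F :: "real set" assume F: "finite F"
    show "\<not> (AE x in \<mu> k. x \<in> F)"
    proof
      assume "AE x in \<mu> k. x \<in> F"
      then have "AE z in \<sigma> k. Re (z ^ (p + 1)) \<in> F"
        unfolding \<mu>_def using finite_imp_closed[OF F] by (subst (asm) AE_distr_iff[OF m]) auto
      \<comment> \<open>Finitely many reals have finitely many (p + 1)-th roots, so the complement
        of S is an open null set and the support would be finite.\<close>
      define S where "S = {z::complex. z ^ (p + 1) \<in> complex_of_real ` F}"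
      have "AE z in \<sigma> k. z \<in> S"
        using AE_star_set[OF k] \<open>AE z in \<sigma> k. Re (z ^ (p + 1)) \<in> F\<close>
      proof eventually_elim
        case (elim z)
        then show ?case unfolding S_def using star_setD(1)[OF elim(1)] by blast
      qed
      have S: "finite S" unfolding S_def by (rule finite_star_preimage[OF F])
      then have "open (- S)" using finite_imp_closed by blast
      then have "- S \<in> sets (\<sigma> k)" using sets_sigma[OF k] by simp
      then have "emeasure (\<sigma> k) (- S) = 0"
        using \<open>AE z in \<sigma> k. z \<in> S\<close> AE_iff_null_sets[of "- S" "\<sigma> k"] by auto
      then have "measure_support (\<sigma> k) \<subseteq> S"
        unfolding measure_support_def using \<open>open (- S)\<close> by force
      then show False
        using S star_measures[OF k] finite_subset unfolding star_measure_def by blast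
    qed
  qed
qed

sublocale nikishin_intervals p a b \<mu>
proof (rule nikishin_intervals.intro)
  show "k < p \<Longrightarrow> interval_measure (\<mu> k) (a k) (b k)" for k by (rule interval_measure_mu)
  show "0 \<notin> {a k<..<b k}" if "k < p" for k
    using even_interval[OF that] odd_interval[OF that] by (cases "even k") auto
  show "{a k..b k} \<inter> {a (Suc k)..b (Suc k)} = {}" if k: "Suc k < p" for k
  proof (rule ccontr)
    assume "\<not> ?thesis"
    then obtain x where x: "x \<in> {a k..b k}" "x \<in> {a (Suc k)..b (Suc k)}" by blast
    \<comment> \<open>A common point of two neighbouring intervals has a root lying on both
      stars.\<close>
    obtain z :: complex where z: "complex_of_real x = z ^ (p + 1)"
      using exists_complex_root[of "p + 1" "complex_of_real x"] by auto
    have "z \<in> star_set p a b k \<inter> star_set p a b (k + 1)"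
      using x by (simp only: star_set_def z[symmetric] mem_Collect_eq Int_iff Suc_eq_plus1 image_eqI simp_thms)
    then show False using disjoint_stars[of k] k by auto
  qed
qed

section \<open>Integration of homogeneous functions over a star\<close>

lemma integral_rotate:
  assumes "k < p" and h: "h \<in> borel_measurable borel"
  shows "(LINT t|\<sigma> k. h (\<omega> * t)) = (LINT t|\<sigma> k. (h t :: complex))"
proof -
  note sets_sigma[OF assms(1), measurable_cong]
  have "(LINT t|\<sigma> k. h t) = (LINT t|distr (\<sigma> k) borel (\<lambda>z. \<omega> * z). h t)"
    using star_measures[OF assms(1)] unfolding star_measure_def \<omega>_def by simp
  also have "\<dots> = (LINT t|\<sigma> k. h (\<omega> * t))"
    using h by (subst integral_distr) auto
  finally show ?thesis ..
qed

text \<open>Invariance turns the integral I into c I.\<close>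

lemma integral_eq_0_of_rotation:
  assumes "k < p" "h \<in> borel_measurable borel" "\<And>t. h (\<omega> * t) = c * h t" "c \<noteq> 1"
  shows "(LINT t|\<sigma> k. (h t :: complex)) = 0"
proof -
  have "(LINT t|\<sigma> k. h t) = c * (LINT t|\<sigma> k. h t)"
    using integral_rotate[OF assms(1,2)] assms(3) by simp
  then show ?thesis using assms(4) by simp
qed

lemma integrable_bounded_on_star:
  fixes h :: "complex \<Rightarrow> complex"
  assumes "k < p" "h \<in> borel_measurable borel" "\<And>t. t \<in> star_set p a b k \<Longrightarrow> norm (h t) \<le> B"
  shows "integrable (\<sigma> k) h"
proof -
  interpret finite_measure "\<sigma> k" by (rule finite_sigma[OF assms(1)])
  have "AE t in \<sigma> k. norm (h t) \<le> B"
    using AE_star_set[OF assms(1)] by eventually_elim (rule assms(3))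
  then show ?thesis
    using assms(2) sets_sigma[OF assms(1)]
    by (intro integrable_const_bound[of _ B]) (auto cong: measurable_cong_sets)
qed

lemma integrable_mult_on_star:
  fixes H f :: "complex \<Rightarrow> complex"
  assumes k: "k < p" and "H \<in> borel_measurable borel" "\<And>t. t \<in> star_set p a b k \<Longrightarrow> norm (H t) \<le> B"
    and "f \<in> borel_measurable borel" "continuous_on (star_set p a b k) f"
  shows "integrable (\<sigma> k) (\<lambda>t. H t * f t)"
proof -
  obtain C where C: "\<And>t. t \<in> star_set p a b k \<Longrightarrow> norm (f t) \<le> C"
    using continuous_on_compact_bounded[OF assms(5) compact_star_set] by blast
  have "norm (H t * f t) \<le> B * C" if t: "t \<in> star_set p a b k" for t
    using C[OF t] assms(3)[OF t] norm_ge_zero[of "H t"] norm_ge_zero[of "f t"]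
    by (simp only: norm_mult) (intro mult_mono; linarith)
  then show ?thesis using assms by (intro integrable_bounded_on_star[OF k]) measurable
qed

text \<open>
  Homogeneity is stated for all t, so that it determines H(0) as well, where the equation
  H(t) t^i = g(t^(p + 1)) carries no information.
\<close>

definition star_function :: "nat \<Rightarrow> nat \<Rightarrow> (real \<Rightarrow> real) \<Rightarrow> (complex \<Rightarrow> complex) \<Rightarrow> bool" where
  "star_function k i g H \<longleftrightarrow> H \<in> borel_measurable borel \<and> (\<forall>t. H (\<omega> * t) * \<omega> ^ i = H t) \<and>
     (\<exists>B. \<forall>t\<in>star_set p a b k. norm (H t) \<le> B) \<and>
     (\<forall>t\<in>star_set p a b k. H t * t ^ i = of_real (g (Re (t ^ (p + 1)))))"

lemma integral_star_function:
  assumes k: "k < p" and H: "star_function k i g H" and g: "g \<in> borel_measurable borel"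
    and f: "f \<in> borel_measurable borel"
  shows "(LINT t|\<sigma> k. H t * t ^ i * f (t ^ (p + 1))) = (LINT x|\<mu> k. of_real (g x) * f (of_real x) :: complex)"
proof -
  note sets_sigma[OF k, measurable_cong]
  have [measurable]: "H \<in> borel_measurable borel" using H by (simp add: star_function_def)
  note g[measurable] f[measurable]
  have "(LINT x|\<mu> k. of_real (g x) * f (of_real x)) =
      (LINT t|\<sigma> k. of_real (g (Re (t ^ (p + 1)))) * f (of_real (Re (t ^ (p + 1)))))"
    unfolding \<mu>_def by (subst integral_distr) auto
  also have "\<dots> = (LINT t|\<sigma> k. H t * t ^ i * f (t ^ (p + 1)))"
  proof (rule integral_cong_AE)
    show "AE t in \<sigma> k. of_real (g (Re (t ^ (p + 1)))) * f (of_real (Re (t ^ (p + 1)))) = H t * t ^ i * f (t ^ (p + 1))"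
      using AE_star_set[OF k]
    proof eventually_elim
      case (elim t)
      have "H t * t ^ i = of_real (g (Re (t ^ (p + 1))))" using H elim by (simp only: star_function_def)
      then show ?case by (simp only: star_setD(1)[OF elim, symmetric])
    qed
  qed measurable
  finally show ?thesis ..
qed

text \<open>
  Expand 1 / (z - t) as the sum of z^(p - i) t^i / (z^(p + 1) - t^(p + 1)) over i from 0 to p; all terms but one
  integrate to zero by rotation.
\<close>

lemma cauchy_integral_star:
  assumes k: "k < p" and i: "i \<le> p" and H: "star_function k i g H" and g: "g \<in> borel_measurable borel"
    and z: "z ^ (p + 1) \<notin> complex_of_real ` {a k..b k}"
  shows "(LINT t|\<sigma> k. H t / (z - t)) = z ^ (p - i) * (LINT x|\<mu> k. of_real (g x) / (z ^ (p + 1) - of_real x))"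
proof -
  note sets_sigma[OF k, measurable_cong]
  let ?n = "p + 1"
  define f where "f i' t = t ^ i' / (z ^ ?n - t ^ ?n)" for i' and t :: complex
  have f_measurable [measurable]: "f i' \<in> borel_measurable borel" for i'
    unfolding f_def[abs_def] by measurable
  have H_measurable [measurable]: "H \<in> borel_measurable borel" using H by (simp add: star_function_def)
  obtain B where B: "\<And>t. t \<in> star_set p a b k \<Longrightarrow> norm (H t) \<le> B"
    using H by (auto simp: star_function_def)
  have nz: "z ^ ?n - t ^ ?n \<noteq> 0" if "t \<in> star_set p a b k" for t
    using that z by (auto simp: star_set_def)
  have int: "integrable (\<sigma> k) (\<lambda>t. H t * f i' t)" for i'
    using nz by (intro integrable_mult_on_star[OF k H_measurable B f_measurable])
      (auto simp: f_def[abs_def] intro!: continuous_intros)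
  have "(LINT t|\<sigma> k. H t / (z - t)) = (LINT t|\<sigma> k. (\<Sum>i'<?n. z ^ (p - i') * (H t * f i' t)))"
  proof (rule integral_cong_AE)
    show "AE t in \<sigma> k. H t / (z - t) = (\<Sum>i'<?n. z ^ (p - i') * (H t * f i' t))"
      using AE_star_set[OF k]
    proof eventually_elim
      case (elim t)
      have "z ^ ?n - t ^ ?n = (z - t) * (\<Sum>i'<?n. z ^ (p - i') * t ^ i')"
        using power_diff_sumr2[of t ?n z] by (simp add: algebra_simps)
      moreover from this nz[OF elim] have "(\<Sum>i'<?n. z ^ (p - i') * t ^ i') \<noteq> 0" by auto
      ultimately have "1 / (z - t) = (\<Sum>i'<?n. z ^ (p - i') * t ^ i') / (z ^ ?n - t ^ ?n)"
        by (simp add: nonzero_divide_mult_cancel_right)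
      then have "H t / (z - t) = H t * ((\<Sum>i'<?n. z ^ (p - i') * t ^ i') / (z ^ ?n - t ^ ?n))"
        by (metis times_divide_eq_right mult.right_neutral)
      also have "\<dots> = (\<Sum>i'<?n. z ^ (p - i') * (H t * f i' t))"
        unfolding f_def sum_divide_distrib sum_distrib_left by (intro sum.cong refl) (simp add: mult_ac)
      finally show ?case .
    qed
  qed measurable
  also have "\<dots> = (\<Sum>i'<?n. z ^ (p - i') * (LINT t|\<sigma> k. H t * f i' t))"
    using Bochner_Integration.integral_sum[OF integrable_mult_right[OF int]]
    by (simp only: integral_mult_right_zero)
  also have "\<dots> = (\<Sum>i'<?n. if i' = i then z ^ (p - i) * (LINT t|\<sigma> k. H t * f i t) else 0)"
  proof (intro sum.cong refl)
    fix i' assume "i' \<in> {..<?n}"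
    show "z ^ (p - i') * (LINT t|\<sigma> k. H t * f i' t) = (if i' = i then z ^ (p - i) * (LINT t|\<sigma> k. H t * f i t) else 0)"
    proof (cases "i' = i")
      case False
      have "(LINT t|\<sigma> k. H t * f i' t) = 0"
      proof (rule integral_eq_0_of_rotation[OF k, where c = "\<omega> ^ (?n - i + i')"])
        show "H (\<omega> * t) * f i' (\<omega> * t) = \<omega> ^ (?n - i + i') * (H t * f i' t)" for t
        proof -
          have "H (\<omega> * t) * \<omega> ^ i = H t" using H by (simp add: star_function_def)
          then have "H (\<omega> * t) * \<omega> ^ (i + (?n - i)) = H t * \<omega> ^ (?n - i)"
            by (simp only: power_add mult.assoc[symmetric])
          moreover have "\<omega> ^ (i + (?n - i)) = 1" using i omega_power_eq_1[of ?n] by simp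
          ultimately have "H (\<omega> * t) = H t * \<omega> ^ (?n - i)" by simp
          then show ?thesis
            unfolding f_def omega_power_mult by (simp only: power_mult_distrib power_add times_divide_eq_right mult_ac)
        qed
        have "\<not> ?n dvd ?n - i + i'"
        proof
          assume "?n dvd ?n - i + i'"
          then have "int ?n dvd int ?n + (int i' - int i)"
            using i unfolding int_dvd_int_iff[symmetric] by (simp add: of_nat_diff algebra_simps)
          then have "int ?n dvd int i' - int i" by simp
          moreover have "\<bar>int i' - int i\<bar> < int ?n" using i \<open>i' \<in> {..<?n}\<close> by auto
          ultimately show False using False zdvd_imp_le[of "int ?n" "\<bar>int i' - int i\<bar>"] by simp
        qed
        then show "\<omega> ^ (?n - i + i') \<noteq> 1" by (simp only: omega_power_eq_1 not_False_eq_True)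
      qed measurable
      then show ?thesis using False by simp
    qed simp
  qed
  also have "\<dots> = z ^ (p - i) * (LINT t|\<sigma> k. H t * f i t)" using i by simp
  also have "(LINT t|\<sigma> k. H t * f i t) = (LINT t|\<sigma> k. H t * t ^ i * (1 / (z ^ ?n - t ^ ?n)))"
    by (simp add: f_def)
  also have "\<dots> = (LINT x|\<mu> k. of_real (g x) * (1 / (z ^ ?n - of_real x)))"
    by (rule integral_star_function[OF k H g]) measurable
  finally show ?thesis by simp
qed

text \<open>The Cauchy transform raises the homogeneity exponent by one. The new exponent i' is
  fixed only through its power of \<omega>, that is modulo p + 1, so that it may wrap round from p
  to 0; the total power p - i + i' of t is then a multiple of p + 1 and is absorbed in
  \<open>h\<close>.\<close>

lemma star_function_cauchy:
  assumes k: "k < p" and i: "i \<le> p" and H: "star_function k i g H" and g: "g \<in> borel_measurable borel"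
    and cont: "continuous_on {a k..b k} g" and disj: "{a k..b k} \<inter> {a l..b l} = {}"
    and i': "\<omega> ^ i' = \<omega> ^ Suc i"
    and h: "\<And>x t. x \<in> {a l..b l} \<Longrightarrow> t ^ (p + 1) = of_real x \<Longrightarrow>
      t ^ (p - i + i') * of_real (LINT y|\<mu> k. g y / (x - y)) = (of_real (h x) :: complex)"
  shows "star_function l i' h (\<lambda>z. LINT t|\<sigma> k. H t / (z - t))"
proof -
  have H_measurable: "H \<in> borel_measurable borel" using H by (simp add: star_function_def)
  interpret interval_measure "\<mu> k" "a k" "b k" by (rule interval_measure_mu[OF k])
  let ?T = "\<lambda>x. LINT y|\<mu> k. g y / (x - y)"
  have eq: "(LINT t|\<sigma> k. H t / (z - t)) = z ^ (p - i) * of_real (?T (Re (z ^ (p + 1))))"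
    if z: "z \<in> star_set p a b l" for z
  proof -
    have "z ^ (p + 1) \<notin> complex_of_real ` {a k..b k}"
      using star_setD(2)[OF z] disj by (subst star_setD(1)[OF z]) auto
    from cauchy_integral_star[OF k i H g this] show ?thesis
      unfolding of_real_cauchy_integral star_setD(1)[OF z, symmetric] .
  qed
  have T: "continuous_on {a l..b l} ?T"
    by (rule continuous_on_subset[OF continuous_on_cauchy_integral[OF g cont]]) (use disj in blast)
  have "continuous_on (star_set p a b l) (\<lambda>z. ?T (Re (z ^ (p + 1))))"
    by (rule continuous_on_compose2[OF T]) (intro continuous_intros, use star_setD(2) in blast)
  then have "continuous_on (star_set p a b l) (\<lambda>z. z ^ (p - i) * complex_of_real (?T (Re (z ^ (p + 1)))))"
    by (intro continuous_on_mult continuous_on_of_real) (intro continuous_intros)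
  from continuous_on_compact_bounded[OF this compact_star_set]
  obtain B where B: "\<And>z. z \<in> star_set p a b l \<Longrightarrow> norm (z ^ (p - i) * complex_of_real (?T (Re (z ^ (p + 1))))) \<le> B"
    by blast
  show ?thesis unfolding star_function_def
  proof (intro conjI allI ballI)
    show "(\<lambda>z. LINT t|\<sigma> k. H t / (z - t)) \<in> borel_measurable borel"
      using finite_sigma[OF k] sets_sigma[OF k] H_measurable by (intro borel_measurable_cauchy_integral)
    show "\<exists>B. \<forall>z\<in>star_set p a b l. norm (LINT t|\<sigma> k. H t / (z - t)) \<le> B"
      using B by (intro exI[of _ B] ballI) (simp only: eq)
    fix z :: complex
    \<comment> \<open>Substituting \<omega> t for t takes one factor \<omega> out of the denominator
      and \<open>i\<close> factors out of H.\<close>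
    have "(LINT t|\<sigma> k. H t / (\<omega> * z - t)) = (LINT t|\<sigma> k. H (\<omega> * t) / (\<omega> * z - \<omega> * t))"
      by (rule integral_rotate[OF k, of "\<lambda>t. H t / (\<omega> * z - t)", symmetric]) (use H_measurable in measurable)
    also have "\<dots> * \<omega> ^ Suc i = (LINT t|\<sigma> k. (H (\<omega> * t) / (\<omega> * z - \<omega> * t)) * \<omega> ^ Suc i)"
      by (simp only: integral_mult_left_zero)
    also have "\<dots> = (LINT t|\<sigma> k. H t / (z - t))"
    proof (intro Bochner_Integration.integral_cong refl)
      fix t
      have "H (\<omega> * t) * \<omega> ^ i = H t" using H by (simp add: star_function_def)
      then have "H t / (z - t) = (\<omega> * (H (\<omega> * t) * \<omega> ^ i)) / (\<omega> * (z - t))" by simp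
      then show "(H (\<omega> * t) / (\<omega> * z - \<omega> * t)) * \<omega> ^ Suc i = H t / (z - t)"
        by (simp only: right_diff_distrib times_divide_eq_left times_divide_eq_right power_Suc mult_ac)
    qed
    finally show "(LINT t|\<sigma> k. H t / (\<omega> * z - t)) * \<omega> ^ i' = (LINT t|\<sigma> k. H t / (z - t))"
      unfolding i' .
  next
    fix z assume z: "z \<in> star_set p a b l"
    show "(LINT t|\<sigma> k. H t / (z - t)) * z ^ i' = of_real (h (Re (z ^ (p + 1))))"
      unfolding eq[OF z] h[OF star_setD(2)[OF z] star_setD(1)[OF z], symmetric]
      by (simp only: power_add mult_ac)
  qed
qed

text \<open>The exponents p - m from the Cauchy transform and m + 1 from the normalisation add up to
  p + 1, which is the single factor y in \<open>reduced_density\<close>.\<close>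

lemma star_function_nikishin_density:
  "k + m < p \<Longrightarrow> star_function k m (reduced_density \<mu> k m) (nikishin_density \<sigma> k m)"
proof (induction m arbitrary: k)
  case 0
  then show ?case by (auto simp: star_function_def)
next
  case (Suc m)
  show ?case unfolding nikishin_density.simps
  proof (rule star_function_cauchy[where i = m and g = "reduced_density \<mu> (Suc k) m"])
    show "star_function (Suc k) m (reduced_density \<mu> (Suc k) m) (nikishin_density \<sigma> (Suc k) m)"
      using Suc by simp
    show "reduced_density \<mu> (Suc k) m \<in> borel_measurable borel"
      using Suc by (intro borel_measurable_reduced_density) simp
    show "continuous_on {a (Suc k)..b (Suc k)} (reduced_density \<mu> (Suc k) m)"
      using Suc by (intro continuous_on_reduced_density) simp
    show "{a (Suc k)..b (Suc k)} \<inter> {a k..b k} = {}" using disjoint[of k] Suc by auto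
    fix x :: real and t :: complex assume t: "t ^ (p + 1) = of_real x"
    have "p - m + Suc m = p + 1" using Suc by simp
    then show "t ^ (p - m + Suc m) * of_real (LINT y|\<mu> (Suc k). reduced_density \<mu> (Suc k) m y / (x - y))
      = complex_of_real (reduced_density \<mu> k (Suc m) x)"
      using t by (simp only: reduced_density.simps of_real_mult)
  qed (use Suc in auto)
qed

end

section \<open>Multi-orthogonal polynomials\<close>

lemma exists_poly_annihilated:
  fixes L :: "nat \<Rightarrow> 'a::field poly \<Rightarrow> 'a"
  assumes lin: "\<And>i P Q c. i < d \<Longrightarrow> L i (P - smult c Q) = L i P - c * L i Q"
  shows "\<exists>P. P \<noteq> 0 \<and> degree P \<le> d \<and> (\<forall>i<d. L i P = 0)"
proof -
  \<comment> \<open>Each further functional destroys at most one of the degrees that occur in the common kernel.\<close>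
  have "\<exists>E\<subseteq>{..d}. card E = d + 1 - i \<and> (\<forall>e\<in>E. \<exists>P. P \<noteq> 0 \<and> degree P = e \<and> (\<forall>i'<i. L i' P = 0))"
    if "i \<le> d" for i
    using that
  proof (induction i)
    case 0
    have "\<exists>P. P \<noteq> 0 \<and> degree P = e \<and> (\<forall>i'<0. L i' P = 0)" for e
      by (rule exI[of _ "monom 1 e"]) (simp add: degree_monom_eq monom_eq_0_iff)
    then show ?case by (intro exI[of _ "{..d}"] conjI ballI) simp_all
  next
    case (Suc i)
    from Suc(1)[OF Suc_leD[OF Suc(2)]] obtain E where E: "E \<subseteq> {..d}" "card E = d + 1 - i"
      "\<forall>e\<in>E. \<exists>P. P \<noteq> 0 \<and> degree P = e \<and> (\<forall>i'<i. L i' P = 0)" by (elim exE conjE)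
    from bchoice[OF E(3)] obtain F where "\<forall>e\<in>E. F e \<noteq> 0 \<and> degree (F e) = e \<and> (\<forall>i'<i. L i' (F e) = 0)" ..
    then have F: "\<And>e. e \<in> E \<Longrightarrow> F e \<noteq> 0" "\<And>e. e \<in> E \<Longrightarrow> degree (F e) = e"
      "\<And>e i'. e \<in> E \<Longrightarrow> i' < i \<Longrightarrow> L i' (F e) = 0" by simp_all
    have fin: "finite E" using E(1) finite_subset by blast
    define A where "A = {e\<in>E. L i (F e) \<noteq> 0}"
    show ?case
    proof (cases "A = {}")
      case True
      have "d + 1 - Suc i \<le> card E" using E(2) by simp
      then obtain E' where E': "E' \<subseteq> E" "card E' = d + 1 - Suc i"
        by (rule obtain_subset_with_card_n) blast
      have "\<exists>P. P \<noteq> 0 \<and> degree P = e \<and> (\<forall>i'<Suc i. L i' P = 0)" if "e \<in> E'" for e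
        using True F E' that by (intro exI[of _ "F e"]) (auto simp: A_def less_Suc_eq)
      moreover have "E' \<subseteq> {..d}" using E'(1) E(1) by (rule subset_trans)
      ultimately show ?thesis using E'(2) by (intro exI[of _ E'] conjI ballI)
    next
      case False
      have finA: "finite A" using fin by (simp add: A_def)
      \<comment> \<open>The pivot has the least degree among the polynomials that functional
        \<open>i\<close> does not kill. Subtracting multiples of it from the others leaves their
        degrees unchanged, so only \<open>e0\<close> is lost.\<close>
      define e0 where "e0 = Min A"
      have e0: "e0 \<in> A" "\<And>e. e \<in> A \<Longrightarrow> e0 \<le> e" using finA False by (auto simp: e0_def)
      have "\<exists>P. P \<noteq> 0 \<and> degree P = e \<and> (\<forall>i'<Suc i. L i' P = 0)" if e: "e \<in> E - {e0}" for e
      proof (cases "e \<in> A")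
        case False
        then show ?thesis using F e by (intro exI[of _ "F e"]) (auto simp: A_def less_Suc_eq)
      next
        case True
        define c where "c = L i (F e) / L i (F e0)"
        let ?P = "F e - smult c (F e0)"
        have "e0 < e" using e0(2)[OF True] e by auto
        then have lt: "degree (smult c (F e0)) < degree (F e)"
          using F(2)[of e] F(2)[of e0] e e0(1) degree_smult_le[of c "F e0"] by (auto simp: A_def)
        have deg: "degree ?P = e"
          using degree_add_eq_left[of "- smult c (F e0)" "F e"] lt F(2)[of e] e by simp
        moreover have "?P \<noteq> 0" using deg \<open>e0 < e\<close> by auto
        moreover have "L i' ?P = 0" if "i' < Suc i" for i'
          using that lin[of i' "F e" c "F e0"] Suc(2) F(3) e e0(1)
          by (auto simp: c_def A_def less_Suc_eq)
        ultimately show ?thesis by blast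
      qed
      moreover have "card (E - {e0}) = d + 1 - Suc i"
        using E(2) fin e0(1) by (simp add: A_def)
      moreover have "E - {e0} \<subseteq> {..d}" using E(1) by blast
      ultimately show ?thesis by (intro exI[of _ "E - {e0}"] conjI ballI)
    qed
  qed
  from this[OF order_refl] obtain E where E: "E \<subseteq> {..d}" "card E = d + 1 - d"
    "\<forall>e\<in>E. \<exists>P. P \<noteq> 0 \<and> degree P = e \<and> (\<forall>i<d. L i P = 0)" by (elim exE conjE)
  have "E \<noteq> {}" using E(2) by auto
  then obtain e where e: "e \<in> E" by blast
  then have "e \<le> d" using E(1) by auto
  then show ?thesis using bspec[OF E(3) e] by blast
qed

text \<open>The coefficients are recorded because they show that a nonzero W has a nonzero component
  and bound the degree of W from below by that of a component.\<close>

lemma poly_residue_decomposition: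
  fixes W :: "'a::comm_ring_1 poly"
  shows "\<exists>C. (\<forall>t. poly W t = (\<Sum>r<Suc p. t ^ r * poly (C r) (t ^ Suc p))) \<and>
    (\<forall>r\<le>p. \<forall>m. coeff (C r) m = coeff W (r + Suc p * m))"
proof (induction W)
  case 0
  show ?case by (intro exI[of _ "\<lambda>_. 0"]) simp
next
  case (pCons c W)
  then obtain C where C: "\<And>t. poly W t = (\<Sum>r<Suc p. t ^ r * poly (C r) (t ^ Suc p))"
    "\<And>r m. r \<le> p \<Longrightarrow> coeff (C r) m = coeff W (r + Suc p * m)" by blast
  \<comment> \<open>Multiplication by t moves each component to the next residue; the last one wraps
    round to residue 0 with a factor t^(p + 1), hence the \<open>pCons\<close>.\<close>
  define C' where "C' r = (case r of 0 \<Rightarrow> pCons c (C p) | Suc r' \<Rightarrow> C r')" for r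
  have "poly (pCons c W) t = (\<Sum>r<Suc p. t ^ r * poly (C' r) (t ^ Suc p))" for t
  proof -
    have "(\<Sum>r<Suc p. t ^ r * poly (C' r) (t ^ Suc p)) =
        c + t ^ Suc p * poly (C p) (t ^ Suc p) + (\<Sum>r<p. t ^ Suc r * poly (C r) (t ^ Suc p))"
      by (subst sum.lessThan_Suc_shift) (simp add: C'_def)
    also have "\<dots> = c + t * (\<Sum>r<Suc p. t ^ r * poly (C r) (t ^ Suc p))"
      by (simp add: sum_distrib_left distrib_left mult.assoc)
    finally show ?thesis using C(1)[of t] by simp
  qed
  moreover have "coeff (C' r) m = coeff (pCons c W) (r + Suc p * m)" if "r \<le> p" for r m
  proof (cases r)
    case 0
    show ?thesis
    proof (cases m)
      case (Suc m')
      have "r + Suc p * m = Suc (p + Suc p * m')" using 0 Suc by simp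
      then show ?thesis using C(2)[of p m'] 0 Suc by (simp only: C'_def nat.case coeff_pCons_Suc order_refl)
    qed (simp add: 0 C'_def)
  next
    case (Suc r')
    then show ?thesis using C(2)[of r' m] that by (simp add: C'_def)
  qed
  ultimately show ?case by blast
qed

lemma poly_map_poly_Re: "poly (map_poly Re P) x = Re (poly P (complex_of_real x))"
  and poly_map_poly_Im: "poly (map_poly Im P) x = Im (poly P (complex_of_real x))"
  by (induction P) (auto simp: map_poly_pCons)

section \<open>Functions of the second kind in the reduced variable\<close>

context star_system
begin

text \<open>The power of t in the integral defining psi_{n,k+1}. It is the representative of k - r
  modulo p + 1 between 0 and p, and at the same time the homogeneity exponent of Psi_{n,k}.\<close>

definition psi_exponent :: "nat \<Rightarrow> nat \<Rightarrow> nat" where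
  "psi_exponent r k = (if r < Suc k then k - r else p + Suc k - r)"

lemma star_function_Psi:
  assumes r: "r \<le> p" and Q: "\<And>t. poly (Qpoly p \<sigma> n) t = t ^ r * poly (map_poly of_real q) (t ^ (p + 1))"
  shows "k < p \<Longrightarrow> star_function k (psi_exponent r k) (weighted r q k) (Psi p \<sigma> n k)"
proof (induction k)
  case 0
  \<comment> \<open>The sum is 0 for r = 0 and p + 1 otherwise; this is where the weight x^c comes
    from at level 0.\<close>
  have e: "r + psi_exponent r 0 = (p + 1) * shift r 0" using r by (auto simp: psi_exponent_def shift_def)
  show ?case unfolding star_function_def
  proof (intro conjI allI ballI)
    show "Psi p \<sigma> n 0 \<in> borel_measurable borel" by simp
    have "continuous_on (star_set p a b 0) (poly (Qpoly p \<sigma> n))" by (intro continuous_intros)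
    from continuous_on_compact_bounded[OF this compact_star_set]
    show "\<exists>B. \<forall>t\<in>star_set p a b 0. norm (Psi p \<sigma> n 0 t) \<le> B" by (metis Psi.simps(1))
    show "Psi p \<sigma> n 0 (\<omega> * t) * \<omega> ^ psi_exponent r 0 = Psi p \<sigma> n 0 t" for t
    proof -
      have "Psi p \<sigma> n 0 (\<omega> * t) * \<omega> ^ psi_exponent r 0 = \<omega> ^ (r + psi_exponent r 0) * Psi p \<sigma> n 0 t"
        unfolding Psi.simps Q omega_power_mult by (simp only: power_mult_distrib power_add mult_ac)
      moreover have "\<omega> ^ (r + psi_exponent r 0) = 1" unfolding e omega_power_eq_1 by (rule dvd_triv_left)
      ultimately show ?thesis by simp
    qed
    fix t assume t: "t \<in> star_set p a b 0"
    define x where "x = Re (t ^ (p + 1))"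
    have x: "t ^ (p + 1) = of_real x" using star_setD(1)[OF t] by (simp only: x_def)
    have "Psi p \<sigma> n 0 t * t ^ psi_exponent r 0 = t ^ (r + psi_exponent r 0) * of_real (poly q x)"
      unfolding Psi.simps Q x poly_map_poly_of_real by (simp only: power_add mult_ac)
    also have "t ^ (r + psi_exponent r 0) = of_real (x ^ shift r 0)"
      unfolding e power_mult x of_real_power ..
    finally show "Psi p \<sigma> n 0 t * t ^ psi_exponent r 0 = of_real (weighted r q 0 (Re (t ^ (p + 1))))"
      unfolding x_def[symmetric] weighted_def by (simp add: mult.commute)
  qed
next
  case (Suc k)
  let ?i = "psi_exponent r k" and ?i' = "psi_exponent r (Suc k)"
  show ?case unfolding Psi.simps
  proof (rule star_function_cauchy)
    show "k < p" "star_function k ?i (weighted r q k) (Psi p \<sigma> n k)" using Suc by simp_all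
    show "?i \<le> p" using r Suc(2) by (auto simp: psi_exponent_def)
    show "weighted r q k \<in> borel_measurable borel" "continuous_on {a k..b k} (weighted r q k)"
      using Suc(2) by (simp_all add: borel_measurable_weighted continuous_on_weighted)
    show "{a k..b k} \<inter> {a (Suc k)..b (Suc k)} = {}" by (rule disjoint[OF Suc(2)])
    \<comment> \<open>For r = Suc k the exponent drops from p to 0 instead of rising by one; both
      give the same power of \<omega>.\<close>
    consider "r \<le> k" | "r = Suc k" | "Suc k < r" by linarith
    then show "\<omega> ^ ?i' = \<omega> ^ Suc ?i"
    proof cases
      case 2
      then show ?thesis using omega_power_eq_1[of "p + 1"] by (simp add: psi_exponent_def)
    next
      case 3
      then have "?i' = Suc ?i" using r by (simp add: psi_exponent_def)
      then show ?thesis by simp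
    qed (auto simp: psi_exponent_def Suc_diff_le)
    fix x :: real and t :: complex assume t: "t ^ (p + 1) = of_real x"
    \<comment> \<open>One summand is the factor in front of the Cauchy integral in
      \<open>second_kind\<close>, the other the weight at level \<open>Suc k\<close>.\<close>
    have e: "p - ?i + ?i' = (p + 1) * (1 - shift r k + shift r (Suc k))"
      using r Suc(2) by (auto simp: psi_exponent_def shift_def)
    show "t ^ (p - ?i + ?i') * of_real (LINT y|\<mu> k. weighted r q k y / (x - y)) = complex_of_real (weighted r q (Suc k) x)"
      unfolding e power_mult t by (simp add: weighted_def second_kind.simps(2) power_add)
  qed
qed

lemma psi_Suc_eq:
  assumes "k < p" and r: "r = n mod (p + 1)"
    and Q: "\<And>t. poly (Qpoly p \<sigma> n) t = t ^ r * poly (map_poly of_real q) (t ^ (p + 1))"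
  shows "psi p \<sigma> n (Suc k) =
    (\<lambda>z. z ^ (1 - shift r k) * (LINT x|\<mu> k. complex_of_real (weighted r q k x) / (z - of_real x)))"
proof
  fix z
  have "r \<le> p" using r by (simp add: less_Suc_eq_le[symmetric])
  have "(LINT t|\<sigma> k. Psi p \<sigma> n k t * t ^ psi_exponent r k * (1 / (z - t ^ (p + 1)))) =
      (LINT x|\<mu> k. complex_of_real (weighted r q k x) * (1 / (z - of_real x)))"
    by (rule integral_star_function[OF assms(1) star_function_Psi[OF \<open>r \<le> p\<close> Q assms(1)]])
      (use borel_measurable_weighted[OF assms(1)] in measurable)
  moreover have "psi p \<sigma> n (Suc k) z =
      z ^ (1 - shift r k) * (LINT t|\<sigma> k. Psi p \<sigma> n k t * t ^ psi_exponent r k / (z - t ^ (p + 1)))"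
    using r by (simp add: psi_def psi_exponent_def shift_def Let_def)
  ultimately show "psi p \<sigma> n (Suc k) z =
      z ^ (1 - shift r k) * (LINT x|\<mu> k. complex_of_real (weighted r q k x) / (z - of_real x))"
    by simp
qed

text \<open>By \<open>e\<close>, t^(r + l) is t^j times a power of t^(p + 1), and t^j is just what
  turns \<open>nikishin_density\<close> into \<open>reduced_density\<close>.\<close>

lemma integral_component:
  assumes "j < p" and e: "r + l = s * (p + 1) + j"
  shows "(LINT t|\<sigma> 0. (t ^ r * poly P (t ^ (p + 1))) * t ^ l * nikishin_density \<sigma> 0 j t) =
    (LINT x|\<mu> 0. of_real (reduced_density \<mu> 0 j x) * (of_real x ^ s * poly P (of_real x)))"
proof -
  have "(t ^ r * poly P (t ^ (p + 1))) * t ^ l * nikishin_density \<sigma> 0 j t =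
      nikishin_density \<sigma> 0 j t * t ^ j * ((t ^ (p + 1)) ^ s * poly P (t ^ (p + 1)))" for t
  proof -
    have "t ^ r * t ^ l = (t ^ (p + 1)) ^ s * t ^ j"
      unfolding power_add[symmetric] e power_mult[symmetric] by (simp only: mult.commute)
    then have "(t ^ r * t ^ l) * (poly P (t ^ (p + 1)) * nikishin_density \<sigma> 0 j t) =
        ((t ^ (p + 1)) ^ s * t ^ j) * (poly P (t ^ (p + 1)) * nikishin_density \<sigma> 0 j t)" by (rule arg_cong)
    then show ?thesis by (simp only: mult_ac)
  qed
  then have "(LINT t|\<sigma> 0. (t ^ r * poly P (t ^ (p + 1))) * t ^ l * nikishin_density \<sigma> 0 j t) =
      (LINT t|\<sigma> 0. nikishin_density \<sigma> 0 j t * t ^ j * ((t ^ (p + 1)) ^ s * poly P (t ^ (p + 1))))"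
    by (intro Bochner_Integration.integral_cong refl)
  also have "\<dots> = (LINT x|\<mu> 0. of_real (reduced_density \<mu> 0 j x) * (of_real x ^ s * poly P (of_real x)))"
    using integral_star_function[OF _ star_function_nikishin_density[of 0 j], of "\<lambda>w. w ^ s * poly P w"]
      borel_measurable_reduced_density[of 0 j] assms(1) by simp
  finally show ?thesis .
qed

lemma measurable_nikishin_density: "j < p \<Longrightarrow> nikishin_density \<sigma> 0 j \<in> borel_measurable borel"
  using star_function_nikishin_density[of 0 j] by (simp add: star_function_def)

text \<open>The integrand has homogeneity degree r + l - j, not divisible by p + 1; the added p + 1
  keeps the exponent of \<omega> a natural number.\<close>

lemma integral_component_eq_0:
  assumes j: "j < p" and e: "(r + l) mod (p + 1) \<noteq> j"
  shows "(LINT t|\<sigma> 0. (t ^ r * poly P (t ^ (p + 1))) * t ^ l * nikishin_density \<sigma> 0 j t) = 0"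
proof (rule integral_eq_0_of_rotation[where c = "\<omega> ^ (r + l + (p + 1 - j))"])
  note measurable_nikishin_density[OF j, measurable]
  show "(\<lambda>t. (t ^ r * poly P (t ^ (p + 1))) * t ^ l * nikishin_density \<sigma> 0 j t) \<in> borel_measurable borel"
    by measurable
  show "0 < p" using p_pos by simp
  have "\<not> (p + 1) dvd r + l + (p + 1 - j)"
  proof
    assume "(p + 1) dvd r + l + (p + 1 - j)"
    then have "(r + l + (p + 1 - j) + j) mod (p + 1) = (0 + j) mod (p + 1)"
      by (intro mod_add_cong) auto
    moreover have "r + l + (p + 1 - j) + j = r + l + (p + 1)" using j by simp
    ultimately have "(r + l) mod (p + 1) = j mod (p + 1)" by (simp only: mod_add_self2 add_0)
    then show False using e j by simp
  qed
  then show "\<omega> ^ (r + l + (p + 1 - j)) \<noteq> 1" by (simp only: omega_power_eq_1 not_False_eq_True)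
  fix t
  have "nikishin_density \<sigma> 0 j (\<omega> * t) * \<omega> ^ j = nikishin_density \<sigma> 0 j t"
    using star_function_nikishin_density[of 0 j] j by (simp add: star_function_def)
  then have "nikishin_density \<sigma> 0 j (\<omega> * t) * \<omega> ^ (j + (p + 1 - j)) = nikishin_density \<sigma> 0 j t * \<omega> ^ (p + 1 - j)"
    by (simp only: power_add mult.assoc[symmetric])
  moreover have "\<omega> ^ (j + (p + 1 - j)) = 1" using j omega_power_eq_1[of "p + 1"] by simp
  ultimately have "nikishin_density \<sigma> 0 j (\<omega> * t) = nikishin_density \<sigma> 0 j t * \<omega> ^ (p + 1 - j)" by simp
  then show "(\<omega> * t) ^ r * poly P ((\<omega> * t) ^ (p + 1)) * (\<omega> * t) ^ l * nikishin_density \<sigma> 0 j (\<omega> * t) =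
      \<omega> ^ (r + l + (p + 1 - j)) * (t ^ r * poly P (t ^ (p + 1)) * t ^ l * nikishin_density \<sigma> 0 j t)"
    unfolding omega_power_mult by (simp only: power_mult_distrib power_add mult_ac)
qed

lemma integrable_nikishin_density:
  assumes "j < p"
  shows "integrable (\<sigma> 0) (\<lambda>t. poly W t * t ^ l * nikishin_density \<sigma> 0 j t)"
proof -
  obtain B where "\<And>t. t \<in> star_set p a b 0 \<Longrightarrow> norm (nikishin_density \<sigma> 0 j t) \<le> B"
    using star_function_nikishin_density[of 0 j] assms by (auto simp: star_function_def)
  then have "integrable (\<sigma> 0) (\<lambda>t. nikishin_density \<sigma> 0 j t * (poly W t * t ^ l))"
    using assms measurable_nikishin_density[OF assms]
    by (intro integrable_mult_on_star) (auto intro!: continuous_intros)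
  then show ?thesis by (simp only: mult.commute)
qed

text \<open>Clears the floor: the bound on l reads p l \<le> n - j - 1, and for n \<le> j neither
  side admits any l.\<close>

lemma multi_orthogonal_iff:
  "multi_orthogonal p \<sigma> n W \<longleftrightarrow>
    (\<forall>j l. j < p \<longrightarrow> p * l + j < n \<longrightarrow> (LINT t|\<sigma> 0. poly W t * t ^ l * nikishin_density \<sigma> 0 j t) = 0)"
proof -
  have "int l \<le> \<lfloor>(real n - real j - 1) / real p\<rfloor> \<longleftrightarrow> p * l + j < n" for j l
  proof -
    have "int l \<le> \<lfloor>(real n - real j - 1) / real p\<rfloor> \<longleftrightarrow> real l * real p \<le> real n - real j - 1"
      using p_pos by (simp add: le_floor_iff pos_le_divide_eq)
    also have "\<dots> \<longleftrightarrow> real (p * l + j + 1) \<le> real n" by (auto simp: algebra_simps)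
    also have "\<dots> \<longleftrightarrow> p * l + j < n" by (simp only: of_nat_le_iff) auto
    finally show ?thesis .
  qed
  then show ?thesis unfolding multi_orthogonal_def by blast
qed

section \<open>Normality\<close>

lemma multi_orthogonal_diff:
  assumes "multi_orthogonal p \<sigma> n P" "multi_orthogonal p \<sigma> n Q"
  shows "multi_orthogonal p \<sigma> n (P - Q)"
  using assms integrable_nikishin_density unfolding multi_orthogonal_iff
  by (simp add: left_diff_distrib)

lemma orthogonal_windowI:
  assumes "r \<le> p" "q \<noteq> 0" "orthogonal_at r D q 0"
  shows "orthogonal_window p a b \<mu> r D q"
  using assms p_pos by (intro orthogonal_window.intro nikishin_intervals_axioms orthogonal_window_axioms.intro) auto

text \<open>The densities are real, so the real and imaginary parts of the coefficients satisfy the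
  conditions separately. One of them is nonzero, and its degree is at most that of P.\<close>

lemma component_degree_ge:
  assumes r: "r \<le> p" and P: "P \<noteq> 0"
    and orth: "\<And>u. u \<in> {r..<r + D} \<Longrightarrow>
      (LINT x|\<mu> 0. complex_of_real (reduced_density \<mu> 0 (u mod p) x) * (of_real x ^ (u div p) * poly P (of_real x))) = 0"
  shows "D \<le> degree P"
proof -
  interpret M: interval_measure "\<mu> 0" "a 0" "b 0" using p_pos by (intro interval_measure_mu) simp
  have mod: "u mod p < p" for u using p_pos by simp
  have int: "integrable (\<mu> 0) (\<lambda>x. complex_of_real (reduced_density \<mu> 0 (u mod p) x) * (of_real x ^ (u div p) * poly P (of_real x)))" for u
    using borel_measurable_reduced_density[of 0 "u mod p"] continuous_on_reduced_density[of 0 "u mod p"] mod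
    by (intro M.integrable_continuous continuous_intros) auto
  have Re: "orthogonal_at r D (map_poly Re P) 0" unfolding orthogonal_at_def
  proof (intro ballI impI)
    fix u assume "u \<in> {r..<r + D}"
    have "(LINT x|\<mu> 0. x ^ (u div p) * second_kind \<mu> r (map_poly Re P) 0 x * reduced_density \<mu> 0 (u mod p - 0) x) =
        (LINT x|\<mu> 0. Re (complex_of_real (reduced_density \<mu> 0 (u mod p) x) * (of_real x ^ (u div p) * poly P (of_real x))))"
      by (intro Bochner_Integration.integral_cong refl)
        (simp add: poly_map_poly_Re of_real_power[symmetric] del: of_real_power)
    also have "\<dots> = 0" using orth[OF \<open>u \<in> {r..<r + D}\<close>] by (subst integral_Re[OF int]) simp
    finally show "(LINT x|\<mu> 0. x ^ (u div p) * second_kind \<mu> r (map_poly Re P) 0 x * reduced_density \<mu> 0 (u mod p - 0) x) = 0" .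
  qed
  have Im: "orthogonal_at r D (map_poly Im P) 0" unfolding orthogonal_at_def
  proof (intro ballI impI)
    fix u assume "u \<in> {r..<r + D}"
    have "(LINT x|\<mu> 0. x ^ (u div p) * second_kind \<mu> r (map_poly Im P) 0 x * reduced_density \<mu> 0 (u mod p - 0) x) =
        (LINT x|\<mu> 0. Im (complex_of_real (reduced_density \<mu> 0 (u mod p) x) * (of_real x ^ (u div p) * poly P (of_real x))))"
      by (intro Bochner_Integration.integral_cong refl)
        (simp add: poly_map_poly_Im of_real_power[symmetric] del: of_real_power)
    also have "\<dots> = 0" using orth[OF \<open>u \<in> {r..<r + D}\<close>] by (subst integral_Im[OF int]) simp
    finally show "(LINT x|\<mu> 0. x ^ (u div p) * second_kind \<mu> r (map_poly Im P) 0 x * reduced_density \<mu> 0 (u mod p - 0) x) = 0" .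
  qed
  show ?thesis
  proof (cases "map_poly Re P = 0")
    case False
    then have "D \<le> degree (map_poly Re P)"
      using orthogonal_window.le_degree[OF orthogonal_windowI[OF r False Re]] by simp
    then show ?thesis using degree_le[of "degree P" "map_poly Re P"] by (simp add: coeff_map_poly coeff_eq_0)
  next
    case True
    have "map_poly Im P \<noteq> 0"
    proof
      assume "map_poly Im P = 0"
      then have "coeff P i = 0" for i
        using True coeff_map_poly[of Re P i] coeff_map_poly[of Im P i] by (simp add: complex_eq_iff)
      then show False using P by (simp add: poly_eq_iff)
    qed
    then have "D \<le> degree (map_poly Im P)"
      using orthogonal_window.le_degree[OF orthogonal_windowI[OF r _ Im]] by simp
    then show ?thesis using degree_le[of "degree P" "map_poly Im P"] by (simp add: coeff_map_poly coeff_eq_0)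
  qed
qed

text \<open>W need not be symmetric, so it is split by exponents modulo p + 1. For each condition,
  rotation leaves a single component alive; a nonzero component thus satisfies a window of its own,
  and its degree bound lifts to W.\<close>

lemma multi_orthogonal_degree_ge:
  assumes W: "W \<noteq> 0" and orth: "multi_orthogonal p \<sigma> n W"
  shows "n \<le> degree W"
proof -
  obtain C where C: "\<And>t. poly W t = (\<Sum>r<p + 1. t ^ r * poly (C r) (t ^ (p + 1)))"
    "\<And>r m. r \<le> p \<Longrightarrow> coeff (C r) m = coeff W (r + (p + 1) * m)"
    using poly_residue_decomposition[of W p] by auto
  have "\<exists>r\<le>p. C r \<noteq> 0"
  proof (rule ccontr)
    assume "\<not> ?thesis"
    then have "coeff W i = 0" for i
    proof -
      have "i mod (p + 1) \<le> p" by (simp add: less_Suc_eq_le[symmetric])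
      then have "coeff W (i mod (p + 1) + (p + 1) * (i div (p + 1))) = 0"
        using C(2)[of "i mod (p + 1)" "i div (p + 1)"] \<open>\<not> (\<exists>r\<le>p. C r \<noteq> 0)\<close> by simp
      then show ?thesis by (simp only: mod_mult_div_eq)
    qed
    then show False using W by (simp add: poly_eq_iff)
  qed
  then obtain r where r: "r \<le> p" "C r \<noteq> 0" by blast
  \<comment> \<open>D is (n - r) / (p + 1) rounded up, the number of exponents r + (p + 1) m below
    n. The subtraction is exact as r \<le> p.\<close>
  define D where "D = (n + p - r) div (p + 1)"
  have D: "m < D \<longleftrightarrow> r + (p + 1) * m < n" for m
  proof -
    have "m < D \<longleftrightarrow> Suc m * (p + 1) \<le> n + p - r"
      unfolding D_def Suc_le_eq[symmetric] by (rule less_eq_div_iff_mult_less_eq) simp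
    also have "\<dots> \<longleftrightarrow> r + (p + 1) * m < n" using r(1) by (auto simp: algebra_simps)
    finally show ?thesis .
  qed
  have "D \<le> degree (C r)"
  proof (rule component_degree_ge[OF r])
    fix u assume u: "u \<in> {r..<r + D}"
    \<comment> \<open>The exponent l solves r + l = s (p + 1) + j.\<close>
    define s j l where "s = u div p" and "j = u mod p" and "l = u + s - r"
    have j: "j < p" using p_pos by (simp add: j_def)
    have us: "u = s * p + j" by (simp add: s_def j_def)
    have rl: "r + l = s * (p + 1) + j" using u us by (simp add: l_def)
    have "r + (p + 1) * (u - r) < n" using u D[of "u - r"] by auto
    moreover have "p * l + j + (p * r) = (p + 1) * u"
    proof -
      have "p * (r + l) + j = (p + 1) * (s * p + j)" unfolding rl by (simp add: algebra_simps)
      then show ?thesis by (simp add: us algebra_simps)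
    qed
    moreover have "(p + 1) * u = (p + 1) * (u - r) + (p + 1) * r"
      using u by (simp add: distrib_left[symmetric])
    ultimately have "p * l + j < n" by simp
    then have "0 = (LINT t|\<sigma> 0. poly W t * t ^ l * nikishin_density \<sigma> 0 j t)"
      using orth j unfolding multi_orthogonal_iff by simp
    also have "\<dots> = (LINT t|\<sigma> 0. (\<Sum>i<p + 1. (t ^ i * poly (C i) (t ^ (p + 1))) * t ^ l * nikishin_density \<sigma> 0 j t))"
      unfolding C(1) sum_distrib_right ..
    also have "\<dots> = (\<Sum>i<p + 1. LINT t|\<sigma> 0. (t ^ i * poly (C i) (t ^ (p + 1))) * t ^ l * nikishin_density \<sigma> 0 j t)"
    proof (rule Bochner_Integration.integral_sum)
      fix i
      show "integrable (\<sigma> 0) (\<lambda>t. (t ^ i * poly (C i) (t ^ (p + 1))) * t ^ l * nikishin_density \<sigma> 0 j t)"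
        using integrable_nikishin_density[OF j, of "monom 1 i * pcompose (C i) (monom 1 (p + 1))" l]
        by (simp add: poly_monom poly_pcompose)
    qed
    also have "\<dots> = (\<Sum>i<p + 1. if i = r then LINT x|\<mu> 0. of_real (reduced_density \<mu> 0 j x) * (of_real x ^ s * poly (C r) (of_real x)) else 0)"
    proof (intro sum.cong refl)
      fix i assume i: "i \<in> {..<p + 1}"
      show "(LINT t|\<sigma> 0. (t ^ i * poly (C i) (t ^ (p + 1))) * t ^ l * nikishin_density \<sigma> 0 j t) =
        (if i = r then LINT x|\<mu> 0. of_real (reduced_density \<mu> 0 j x) * (of_real x ^ s * poly (C r) (of_real x)) else 0)"
      proof (cases "i = r")
        case True
        then show ?thesis using integral_component[OF j rl] by simp
      next
        case False
        have "(i + l) mod (p + 1) \<noteq> j"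
        proof
          assume "(i + l) mod (p + 1) = j"
          moreover have "(r + l) mod (p + 1) = j" unfolding rl mod_mult_self3 using j by simp
          ultimately have "(i + l) mod (p + 1) = (r + l) mod (p + 1)" by simp
          then have "i mod (p + 1) = r mod (p + 1)" by (simp only: nat_mod_eq_iff) (auto simp: algebra_simps)
          then show False using False i r(1) by simp
        qed
        then show ?thesis using integral_component_eq_0[OF j] False by simp
      qed
    qed
    also have "\<dots> = (LINT x|\<mu> 0. of_real (reduced_density \<mu> 0 j x) * (of_real x ^ s * poly (C r) (of_real x)))"
      using r(1) by simp
    finally show "(LINT x|\<mu> 0. complex_of_real (reduced_density \<mu> 0 (u mod p) x) * (of_real x ^ (u div p) * poly (C r) (of_real x))) = 0"
      by (simp add: j_def s_def)
  qed
  then have "n \<le> r + (p + 1) * degree (C r)"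
    using D[of "degree (C r)"] by linarith
  also have "\<dots> \<le> degree W"
    using C(2)[OF r(1), of "degree (C r)"] r(2) by (intro le_degree) (metis leading_coeff_0_iff)
  finally show ?thesis .
qed

text \<open>There are d linear conditions on the real polynomials of degree at most d, so a nonzero
  solution exists; \<open>orthogonal_window.le_degree\<close> forces its degree to be d, and it can
  be made monic.\<close>

lemma exists_window_polynomial:
  assumes r: "r \<le> p"
  obtains q where "degree q = d" "lead_coeff q = 1" "orthogonal_at r d q 0"
proof -
  interpret M: interval_measure "\<mu> 0" "a 0" "b 0" using p_pos by (intro interval_measure_mu) simp
  define L where "L i P = (LINT x|\<mu> 0. x ^ ((r + i) div p) * poly P x * reduced_density \<mu> 0 ((r + i) mod p) x)" for i P
  have mod: "u mod p < p" for u using p_pos by simp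
  have int: "integrable (\<mu> 0) (\<lambda>x. x ^ ((r + i) div p) * poly P x * reduced_density \<mu> 0 ((r + i) mod p) x)" for i P
    using borel_measurable_reduced_density[of 0 "(r + i) mod p"] continuous_on_reduced_density[of 0 "(r + i) mod p"] mod
    by (intro M.integrable_continuous continuous_intros) auto
  have "L i (P - smult c Q) = L i P - c * L i Q" for i P Q c
  proof -
    have "L i (P - smult c Q) = (LINT x|\<mu> 0. x ^ ((r + i) div p) * poly P x * reduced_density \<mu> 0 ((r + i) mod p) x
        - c * (x ^ ((r + i) div p) * poly Q x * reduced_density \<mu> 0 ((r + i) mod p) x))"
      unfolding L_def by (intro Bochner_Integration.integral_cong refl) (simp add: algebra_simps)
    then show ?thesis
      unfolding Bochner_Integration.integral_diff[OF int integrable_mult_right[OF int]] integral_mult_right_zero L_def .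
  qed
  then obtain P where P: "P \<noteq> 0" "degree P \<le> d" "\<And>i. i < d \<Longrightarrow> L i P = 0"
    using exists_poly_annihilated[of d L] by auto
  define q where "q = smult (1 / lead_coeff P) P"
  have orth: "orthogonal_at r d q 0" unfolding orthogonal_at_def
  proof (intro ballI impI)
    fix u assume u: "u \<in> {r..<r + d}"
    have "(LINT x|\<mu> 0. x ^ (u div p) * second_kind \<mu> r q 0 x * reduced_density \<mu> 0 (u mod p - 0) x) =
        (LINT x|\<mu> 0. (1 / lead_coeff P) * (x ^ (u div p) * poly P x * reduced_density \<mu> 0 (u mod p) x))"
      by (intro Bochner_Integration.integral_cong refl) (simp add: q_def)
    also have "\<dots> = (1 / lead_coeff P) * L (u - r) P"
      using u by (simp only: integral_mult_right_zero L_def atLeastLessThan_iff le_add_diff_inverse)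
    also have "\<dots> = 0" using u P(3)[of "u - r"] by auto
    finally show "(LINT x|\<mu> 0. x ^ (u div p) * second_kind \<mu> r q 0 x * reduced_density \<mu> 0 (u mod p - 0) x) = 0" .
  qed
  have "q \<noteq> 0" "lead_coeff q = 1" "degree q = degree P" using P(1) by (auto simp: q_def)
  moreover have "d \<le> degree q"
    by (rule orthogonal_window.le_degree[OF orthogonal_windowI[OF r \<open>q \<noteq> 0\<close> orth]])
  ultimately show ?thesis using that[of q] orth P(2) by simp
qed

text \<open>The candidate has degree n, which normality shows to be minimal. Uniqueness follows
  likewise: the difference of two monic solutions of degree n has smaller degree, so it
  vanishes.\<close>

lemma Qpoly_eq:
  assumes r: "r = n mod (p + 1)" and d: "d = n div (p + 1)"
    and q: "degree q = d" "lead_coeff q = 1" "orthogonal_at r d q 0"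
  shows "poly (Qpoly p \<sigma> n) t = t ^ r * poly (map_poly of_real q) (t ^ (p + 1))"
proof -
  have rp: "r \<le> p" using r by (simp add: less_Suc_eq_le[symmetric])
  have n: "n = r + (p + 1) * d" unfolding r d by (rule mod_mult_div_eq[symmetric])
  define P where "P = map_poly complex_of_real q"
  define Q where "Q = monom 1 r * pcompose P (monom 1 (p + 1))"
  have Q: "poly Q t = t ^ r * poly P (t ^ (p + 1))" for t by (simp add: Q_def poly_monom poly_pcompose)
  have P: "degree P = d" "lead_coeff P = 1"
    using q by (auto simp: P_def degree_map_poly_of_real coeff_map_poly)
  have lead: "lead_coeff Q = 1"
    unfolding Q_def lead_coeff_mult using P by (subst lead_coeff_comp) (auto simp: degree_monom_eq)
  have degQ: "degree Q = n"
    unfolding Q_def n using P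
    by (subst degree_mult_eq) (auto simp: degree_pcompose degree_monom_eq monom_eq_0_iff pcompose_eq_0_iff)
  have orthQ: "multi_orthogonal p \<sigma> n Q" unfolding multi_orthogonal_iff
  proof (intro allI impI)
    fix j l assume j: "j < p" and l: "p * l + j < n"
    show "(LINT t|\<sigma> 0. poly Q t * t ^ l * nikishin_density \<sigma> 0 j t) = 0"
    proof (cases "(r + l) mod (p + 1) = j")
      case False
      then show ?thesis unfolding Q by (rule integral_component_eq_0[OF j])
    next
      case True
      define s where "s = (r + l) div (p + 1)"
      have rl: "r + l = s * (p + 1) + j" using True by (metis s_def div_mult_mod_eq)
      define u where "u = s * p + j"
      have u: "u div p = s" "u mod p = j" using j by (auto simp: u_def)
      have "r \<le> u" using rl rp by (cases s) (auto simp: u_def)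
      \<comment> \<open>Here p l + j = (p + 1) u - p r, while n = r + (p + 1) d.\<close>
      moreover have "u < r + d"
      proof -
        have "p * l + j + p * r = (p + 1) * u"
        proof -
          have "p * (r + l) + j = (p + 1) * (s * p + j)" unfolding rl by (simp add: algebra_simps)
          then show ?thesis by (simp add: u_def algebra_simps)
        qed
        then have "(p + 1) * u < (p + 1) * (r + d)" using l n by (simp add: algebra_simps)
        then show ?thesis by (simp only: mult_less_cancel1)
      qed
      ultimately have zero: "(LINT x|\<mu> 0. x ^ s * poly q x * reduced_density \<mu> 0 j x) = 0"
        using q(3) u unfolding orthogonal_at_def by (metis atLeastLessThan_iff diff_zero le0 second_kind.simps(1))
      have "(LINT t|\<sigma> 0. poly Q t * t ^ l * nikishin_density \<sigma> 0 j t) =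
          (LINT x|\<mu> 0. of_real (reduced_density \<mu> 0 j x) * (of_real x ^ s * poly P (of_real x)))"
        unfolding Q by (rule integral_component[OF j rl])
      also have "\<dots> = (LINT x|\<mu> 0. complex_of_real (x ^ s * poly q x * reduced_density \<mu> 0 j x))"
        by (simp add: P_def poly_map_poly_of_real mult_ac)
      also have "\<dots> = 0" by (simp only: integral_complex_of_real zero of_real_0)
      finally show ?thesis .
    qed
  qed
  have min: "n \<le> degree R" if "lead_coeff R = 1" "multi_orthogonal p \<sigma> n R" for R
    using that by (intro multi_orthogonal_degree_ge) auto
  have "Qpoly p \<sigma> n = Q" unfolding Qpoly_def
  proof (rule the_equality)
    show "lead_coeff Q = 1 \<and> multi_orthogonal p \<sigma> n Q \<and>
        (\<forall>R. lead_coeff R = 1 \<and> multi_orthogonal p \<sigma> n R \<longrightarrow> degree Q \<le> degree R)"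
      using lead orthQ min degQ by blast
    fix R assume R: "lead_coeff R = 1 \<and> multi_orthogonal p \<sigma> n R \<and>
        (\<forall>S. lead_coeff S = 1 \<and> multi_orthogonal p \<sigma> n S \<longrightarrow> degree R \<le> degree S)"
    then have degR: "degree R = n" using min[of R] lead orthQ degQ by (metis antisym)
    show "R = Q"
    proof (rule ccontr)
      assume "R \<noteq> Q"
      then have "n \<le> degree (R - Q)"
        using R orthQ by (intro multi_orthogonal_degree_ge multi_orthogonal_diff) auto
      moreover have "degree (R - Q) \<le> n" using degR degQ by (intro degree_diff_le) auto
      ultimately have "degree (R - Q) = n" by simp
      moreover have "coeff (R - Q) n = 0" using R lead degR degQ by simp
      ultimately have "R - Q = 0" by (metis leading_coeff_0_iff)
      then show False using \<open>R \<noteq> Q\<close> by simp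
    qed
  qed
  then show ?thesis using Q P_def by simp
qed

text \<open>The factor t^r can be cancelled away from 0 only, but there every w is a (p + 1)-th
  power, so two candidates agree at infinitely many points.\<close>

lemma reduced_Qpoly_eq:
  assumes "\<And>t. poly (Qpoly p \<sigma> n) t = t ^ (n mod (p + 1)) * poly P (t ^ (p + 1))"
  shows "reduced_Qpoly p \<sigma> n = P"
  unfolding reduced_Qpoly_def
proof (rule the_equality)
  show "\<forall>t. poly (Qpoly p \<sigma> n) t = t ^ (n mod (p + 1)) * poly P (t ^ (p + 1))" using assms by simp
  fix R assume R: "\<forall>t. poly (Qpoly p \<sigma> n) t = t ^ (n mod (p + 1)) * poly R (t ^ (p + 1))"
  show "R = P"
  proof (rule ccontr)
    assume "R \<noteq> P"
    have "poly (R - P) w = 0" if "w \<noteq> 0" for w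
    proof -
      obtain t where w: "w = t ^ (p + 1)" using exists_complex_root[of "p + 1" w] by auto
      then have "t \<noteq> 0" using that by auto
      have "t ^ (n mod (p + 1)) * poly R w = t ^ (n mod (p + 1)) * poly P w"
        using R assms[of t] unfolding w by metis
      then show ?thesis using \<open>t \<noteq> 0\<close> by simp
    qed
    then have "- {0} \<subseteq> {w. poly (R - P) w = 0}" by auto
    moreover have "finite {w. poly (R - P) w = 0}" using \<open>R \<noteq> P\<close> by (intro poly_roots_finite) simp
    ultimately have "finite (- {0} :: complex set)" by (rule finite_subset)
    then show False using infinite_UNIV_char_0[where 'a = complex] by (simp add: finite_compl)
  qed
qed

end

section \<open>The counting numbers and the conclusion\<close>

lemma Mcount_eq_card:
  assumes p: "p \<ge> 1" and j: "j < p" and r: "r = n mod (p + 1)" and d: "d = n div (p + 1)"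
  shows "Mcount p n j = card {u\<in>{r..<r + d}. u mod p = j}"
proof -
  have rp: "r \<le> p" using r by (simp add: less_Suc_eq_le[symmetric])
  have n: "n = r + (p + 1) * d" unfolding r d by (rule mod_mult_div_eq[symmetric])
  define S where "S = {s::nat. s * p + j \<in> {r..<r + d}}"
  have "{s::int. \<lceil>(real r - real j) / (real p + 1)\<rceil> \<le> s \<and>
      s \<le> \<lfloor>(real n + real p * real r - 1 - real j * (real p + 1)) / (real p * (real p + 1))\<rfloor>} = int ` S"
  proof (intro equalityI subsetI)
    fix s :: int
    assume "s \<in> {s::int. \<lceil>(real r - real j) / (real p + 1)\<rceil> \<le> s \<and>
      s \<le> \<lfloor>(real n + real p * real r - 1 - real j * (real p + 1)) / (real p * (real p + 1))\<rfloor>}"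
    then have s: "real r - real j \<le> of_int s * (real p + 1)"
      "of_int s * (real p * (real p + 1)) \<le> real n + real p * real r - 1 - real j * (real p + 1)"
      using p by (auto simp: ceiling_le_iff le_floor_iff pos_divide_le_eq pos_le_divide_eq)
    have "real_of_int (int r - int j) \<le> of_int (s * (int p + 1))" using s(1) by simp
    then have s1: "int r - int j \<le> s * (int p + 1)" by (simp only: of_int_le_iff)
    have "real_of_int (s * (int p * (int p + 1))) \<le> of_int (int n + int p * int r - 1 - int j * (int p + 1))"
      using s(2) by simp
    then have s2: "s * (int p * (int p + 1)) \<le> int n + int p * int r - 1 - int j * (int p + 1)"
      by (simp only: of_int_le_iff)
    \<comment> \<open>As j < p, the lower limit (r - j) / (p + 1) exceeds -1.\<close>
    have "0 \<le> s"
    proof (rule ccontr)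
      assume "\<not> 0 \<le> s"
      then have "s * (int p + 1) \<le> - (int p + 1)" using mult_right_mono[of s "-1" "int p + 1"] by simp
      moreover have "int j < int p" using j by simp
      ultimately show False using s1 by linarith
    qed
    then obtain m where m: "s = int m" using nonneg_int_cases by blast
    \<comment> \<open>The defining bound has p + 1 in place of p. For m = 0 this makes no
      difference, and for m \<ge> 1 the claim holds anyway because r \<le> p.\<close>
    have "r \<le> m * p + j" using s1 m rp by (cases m) (auto simp: algebra_simps)
    moreover have "m * p + j < r + d"
    proof -
      \<comment> \<open>Moving j (p + 1) to the left leaves n + p r = (p + 1) (r + d) as a strict
        upper bound.\<close>
      have "int ((p + 1) * (m * p + j)) < int ((p + 1) * (r + d))"
        using s2 unfolding m n by (simp add: algebra_simps)
      then have "(p + 1) * (m * p + j) < (p + 1) * (r + d)" by (simp only: of_nat_less_iff)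
      then show ?thesis by (simp only: mult_less_cancel1)
    qed
    ultimately show "s \<in> int ` S" using m by (auto simp: S_def)
  next
    fix s assume "s \<in> int ` S"
    then obtain m where m: "s = int m" "r \<le> m * p + j" "m * p + j < r + d" by (auto simp: S_def)
    have "real r - real j \<le> real m * (real p + 1)"
    proof -
      have "real r \<le> real (m * p + j)" using m(2) by (simp only: of_nat_le_iff)
      then show ?thesis by (simp add: algebra_simps)
    qed
    moreover have "real m * (real p * (real p + 1)) \<le> real n + real p * real r - 1 - real j * (real p + 1)"
    proof -
      have "(p + 1) * (m * p + j + 1) \<le> (p + 1) * (r + d)" using m(3) by (intro mult_left_mono) auto
      then have "real ((p + 1) * (m * p + j + 1)) \<le> real ((p + 1) * (r + d))" by (simp only: of_nat_le_iff)
      then show ?thesis unfolding n by (simp add: algebra_simps)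
    qed
    ultimately show "s \<in> {s::int. \<lceil>(real r - real j) / (real p + 1)\<rceil> \<le> s \<and>
      s \<le> \<lfloor>(real n + real p * real r - 1 - real j * (real p + 1)) / (real p * (real p + 1))\<rfloor>}"
      using p m(1) by (simp add: ceiling_le_iff le_floor_iff pos_divide_le_eq pos_le_divide_eq)
  qed
  then have "Mcount p n j = card (int ` S)" using r by (simp add: Mcount_def)
  also have "\<dots> = card S" by (intro card_image) simp
  also have "\<dots> = card ((\<lambda>s. s * p + j) ` S)" using p by (intro card_image[symmetric]) (auto simp: inj_on_def)
  also have "(\<lambda>s. s * p + j) ` S = {u\<in>{r..<r + d}. u mod p = j}"
  proof (intro equalityI subsetI)
    fix u assume u: "u \<in> {u\<in>{r..<r + d}. u mod p = j}"
    then have "u = (u div p) * p + j" by auto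
    then show "u \<in> (\<lambda>s. s * p + j) ` S" using u by (intro image_eqI[of _ _ "u div p"]) (auto simp: S_def)
  qed (use j in \<open>auto simp: S_def\<close>)
  finally show ?thesis .
qed

theorem proposition2p19:
  fixes p n :: nat and a b :: "nat \<Rightarrow> real" and \<sigma> :: "nat \<Rightarrow> complex measure"
  assumes "p \<ge> 1"
    and "\<And>j. j < p \<Longrightarrow> even j \<Longrightarrow> 0 \<le> a j \<and> a j < b j"
    and "\<And>j. j < p \<Longrightarrow> odd j \<Longrightarrow> a j < b j \<and> b j \<le> 0"
    and "\<And>j. j + 1 < p \<Longrightarrow> star_set p a b j \<inter> star_set p a b (j + 1) = {}"
    and "\<And>j. j < p \<Longrightarrow> star_measure p a b j (\<sigma> j)"
  shows "(\<forall>k<p. finite (psi_zeros p a b \<sigma> n k) \<and>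
             card (psi_zeros p a b \<sigma> n k) = Zcount p n k \<and>
             (\<forall>z\<in>psi_zeros p a b \<sigma> n k. zorder (psi p \<sigma> n k) z = 1) \<and>
             psi_zeros p a b \<sigma> n k \<subseteq> complex_of_real ` {a k<..<b k}) \<and>
         psi_zeros p a b \<sigma> n p = {}"
proof -
  interpret star_system p a b \<sigma> using assms by unfold_locales
  define r d where "r = n mod (p + 1)" and "d = n div (p + 1)"
  have rp: "r \<le> p" by (simp add: r_def less_Suc_eq_le[symmetric])
  obtain q where q: "degree q = d" "lead_coeff q = 1" "orthogonal_at r d q 0"
    using exists_window_polynomial[OF rp] .
  have "q \<noteq> 0" using q(2) by auto
  interpret orthogonal_window_exact p a b \<mu> r d q
    using orthogonal_windowI[OF rp \<open>q \<noteq> 0\<close> q(3)] q(1)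
    by (intro orthogonal_window_exact.intro orthogonal_window_exact_axioms.intro)
  note Q = Qpoly_eq[OF r_def d_def q]
  have Z: "Zcount p n k = (\<Sum>j=k..<p. level_count j)" for k
    unfolding Zcount_def level_count_def
    using Mcount_eq_card[OF p_pos _ r_def d_def] by (intro sum.cong) auto
  have psi_Suc: "psi p \<sigma> n (Suc k) = (\<lambda>z. z ^ (1 - shift r k) * transform k z)"
    "psi_zeros p a b \<sigma> n (Suc k) = transform_zeros k" if "k < p" for k
  proof -
    show eq: "psi p \<sigma> n (Suc k) = (\<lambda>z. z ^ (1 - shift r k) * transform k z)"
      by (rule psi_Suc_eq[OF that r_def Q])
    show "psi_zeros p a b \<sigma> n (Suc k) = transform_zeros k"
      unfolding psi_zeros_def eq transform_zeros_def cut_def by auto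
  qed
  have "finite (psi_zeros p a b \<sigma> n k) \<and> card (psi_zeros p a b \<sigma> n k) = Zcount p n k \<and>
      (\<forall>z\<in>psi_zeros p a b \<sigma> n k. zorder (psi p \<sigma> n k) z = 1) \<and>
      psi_zeros p a b \<sigma> n k \<subseteq> complex_of_real ` {a k<..<b k}" if k: "k < p" for k
  proof (cases k)
    case 0
    let ?P = "map_poly complex_of_real q"
    have "reduced_Qpoly p \<sigma> n = ?P" using Q unfolding r_def by (rule reduced_Qpoly_eq)
    then have psi0: "psi p \<sigma> n 0 = poly ?P" by (auto simp: psi_def Let_def)
    \<comment> \<open>\<open>psi_zeros\<close> omits the origin; no root is lost by this, since the
      open interval (a 0, b 0) omits it too.\<close>
    have "0 \<notin> {z. poly ?P z = 0}" using zeros_of_poly(2) zero_notin[of 0] p_pos by force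
    then have zeros: "psi_zeros p a b \<sigma> n 0 = {z. poly ?P z = 0}"
      unfolding psi_zeros_def psi0 cut_def by auto
    have "finite {z. poly ?P z = 0}"
      using \<open>q \<noteq> 0\<close> by (intro poly_roots_finite) (simp add: map_poly_eq_0_iff)
    then show ?thesis
      unfolding 0 zeros psi0 Z using zeros_of_poly by blast
  next
    case (Suc m)
    then have m: "m < p" "Suc m < p" using k by auto
    show ?thesis
      unfolding Suc psi_Suc[OF m(1)] Z using zeros_of_transform[OF m(1)] m(2) by blast
  qed
  moreover have "psi_zeros p a b \<sigma> n p = {}"
  proof -
    obtain m where m: "p = Suc m" using p_pos by (cases p) auto
    then have "m < p" by simp
    \<comment> \<open>psi_{n,p} belongs to the transform at the last level, where the sum of the
      later counts is empty.\<close>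
    have "psi_zeros p a b \<sigma> n (Suc m) = {}"
      unfolding psi_Suc(2)[OF \<open>m < p\<close>]
      using zeros_of_transform(1,2)[OF \<open>m < p\<close>] m by simp
    then show ?thesis using m by simp
  qed
  ultimately show ?thesis by blast
qed

end
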